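(* Let $n$ be a positive integer. Every independent set in the graph $\mathcal{B}_n$ has size at most $n!/2^{(n-4)/2}$.
   Context: $S_n$ is the symmetric group on $[n]=\{1,\ldots,n\}$. A permutation $\tau\in S_n$ is called a cycle if, except for its fixed points, it consists of a single non-trivial cycle (of any length between $2$ and $n$; in particular the identity is not a cycle). Let $\mathcal{C}_n\subset S_n$ be the set of cycles. The (Birkhoff polytope) graph $\mathcal{B}_n=\mathrm{Cay}(S_n,\mathcal{C}_n)$ is the undirected graph with vertex set $S_n$ and edges $\{\pi,\tau\pi\}$ for $\pi\in S_n$, $\tau\in\mathcal{C}_n$. An independent set is a set $A\subset S_n$ containing no two adjacent vertices, i.e. there are no $\pi,\pi'\in A$ with $\pi(\pi')^{-1}\in\mathcal{C}_n$. *)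

theory Defs
  imports Complex_Main "HOL-Algebra.Sym_Groups"
begin

text \<open>An undirected graph is given by its vertex set and its set of (unordered) edges.\<close>

type_synonym 'a ugraph = "'a set \<times> 'a set set"

definition cayley_graph :: "('a, 'b) monoid_scheme \<Rightarrow> 'a set \<Rightarrow> 'a ugraph" where
  "cayley_graph G S = (carrier G, {{g, s \<otimes>\<^bsub>G\<^esub> g} | g s. g \<in> carrier G \<and> s \<in> S})"

definition independent_set :: "'a ugraph \<Rightarrow> 'a set \<Rightarrow> bool" where
  "independent_set H A \<longleftrightarrow> A \<subseteq> fst H \<and> (\<forall>x\<in>A. \<forall>y\<in>A. {x, y} \<notin> snd H)"

text \<open>
  The library abbreviation \<open>cycle cs\<close> only says that \<open>cs\<close> is distinct; the length bound
  excludes the identity, which is \<open>cycle_of_list cs\<close> for lists of length 0 and 1.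
\<close>

definition cycles :: "nat \<Rightarrow> (nat \<Rightarrow> nat) set" where
  "cycles n = {cycle_of_list cs | cs. cycle cs \<and> set cs \<subseteq> {1..n} \<and> length cs \<ge> 2}"

definition birkhoff_graph :: "nat \<Rightarrow> (nat \<Rightarrow> nat) ugraph" where
  "birkhoff_graph n = cayley_graph (sym_group n) (cycles n)"

lemma cycles_subset: "cycles n \<subseteq> carrier (sym_group n)"
  by (auto simp: cycles_def sym_group_carrier intro: permutes_subset[OF cycle_permutes])

lemma birkhoff_graph_edge_iff:
  assumes "p permutes {1..n}" and "q permutes {1..n}"
  shows "{p, q} \<in> snd (birkhoff_graph n) \<longleftrightarrow> p \<circ> inv' q \<in> cycles n \<or> q \<circ> inv' p \<in> cycles n"
proof -
  have *: "s \<circ> g \<circ> inv' g = s" "s \<circ> inv' g \<circ> g = s"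
    if "g permutes {1..n}" for s g :: "nat \<Rightarrow> nat"
    using permutes_inv_o[OF that] by (simp_all add: comp_assoc)
  have "{p, q} \<in> snd (birkhoff_graph n) \<longleftrightarrow>
      (\<exists>g s. {p, q} = {g, s \<circ> g} \<and> g permutes {1..n} \<and> s \<in> cycles n)"
    by (simp add: birkhoff_graph_def cayley_graph_def sym_group_carrier sym_group_mult)
  also have "\<dots> \<longleftrightarrow> (\<exists>s\<in>cycles n. q = s \<circ> p \<or> p = s \<circ> q)"
    using assms by (auto simp: doubleton_eq_iff)
  also have "\<dots> \<longleftrightarrow> p \<circ> inv' q \<in> cycles n \<or> q \<circ> inv' p \<in> cycles n"
    using *[OF assms(1)] *[OF assms(2)] by metis
  finally show ?thesis .
qed

lemma independent_set_birkhoff_graph_iff: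
  "independent_set (birkhoff_graph n) A \<longleftrightarrow>
    A \<subseteq> {p. p permutes {1..n}} \<and> (\<forall>p\<in>A. \<forall>q\<in>A. p \<circ> inv' q \<notin> cycles n)"
proof -
  have "fst (birkhoff_graph n) = {p. p permutes {1..n}}"
    by (simp add: birkhoff_graph_def cayley_graph_def sym_group_def)
  then show ?thesis
    using birkhoff_graph_edge_iff unfolding independent_set_def by blast
qed

end

theory Submission
  imports Defs
begin

text \<open>
  Let \<open>A\<close> be a set of bijections between sets of odd size \<open>n\<close>, all of the same parity, in which no two
  elements differ by a cycle. Write \<open>a j\<close> for the squared Hilbert-Schmidt norm of \<open>\<Sum>p\<in>A. p\<close> acting on the
  \<open>j\<close>-th exterior power of the standard representation, divided by the square of \<open>card A\<close>. Then \<open>a 0 = 1\<close>,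
  and \<open>a (n - 1 - j) = a j\<close> because of the constant parity. The alternating sum of
  the traces of \<open>g\<close> on these exterior powers is \<open>det (1 - g)\<close> on the standard representation, which vanishes
  unless \<open>g\<close> is an \<open>n\<close>-cycle; hence the alternating sum of the \<open>a j\<close> is \<open>0\<close>.

  On the other hand, restricting \<open>A\<close> to the bijections with \<open>p x = y\<close> and summing over \<open>x\<close> and \<open>y\<close>
  dominates \<open>a j + a (j + 1)\<close>, by Bessel's inequality for the two copies of exterior powers
  in the induced representation. Iterating \<open>k\<close> times produces binomial coefficients: for \<open>k\<close> even, if the theorem
  holds for \<open>n - k\<close> and fails for \<open>A\<close>, then \<open>\<Sum>j\<le>k. (k choose j) * a j \<le> 2 ^ (k / 2)\<close>. These
  inequalities make the odd \<open>a j\<close> too small for the alternating sum to vanish.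
\<close>

section \<open>Signs of maps\<close>

definition pair_sign :: "'a::linorder \<Rightarrow> 'a \<Rightarrow> real" where
  "pair_sign x y = (if x < y then 1 else -1)"

text \<open>For \<open>x\<close> outside \<open>S\<close>, the sign that relates the wedge of e_x
  with e_S to the basis wedge of \<open>insert x S\<close>, all basis wedges being taken in
  increasing order.\<close>

definition pos_sign :: "'a::linorder \<Rightarrow> 'a set \<Rightarrow> real" where
  "pos_sign x S = (\<Prod>z\<in>S. pair_sign x z)"

text \<open>For \<open>f\<close> injective on \<open>S\<close> this is the parity of the inversions
  of \<open>f\<close>, i.e. the sign with which \<open>f\<close> carries e_S to the basis wedge of
  the image of \<open>S\<close>.\<close>

definition map_sign :: "('a::linorder \<Rightarrow> 'b::linorder) \<Rightarrow> 'a set \<Rightarrow> real" where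
  "map_sign f S = (\<Prod>(x, y)\<in>{(x, y). x \<in> S \<and> y \<in> S \<and> x < y}. pair_sign (f x) (f y))"

lemma pair_sign_square [simp]: "pair_sign x y * pair_sign x y = 1"
  by (simp add: pair_sign_def)

lemma pair_sign_swap: "x \<noteq> y \<Longrightarrow> pair_sign y x = - pair_sign x y"
  by (auto simp: pair_sign_def)

lemma pos_sign_empty [simp]: "pos_sign x {} = 1"
  by (simp add: pos_sign_def)

lemma pos_sign_insert [simp]:
  "finite S \<Longrightarrow> y \<notin> S \<Longrightarrow> pos_sign x (insert y S) = pair_sign x y * pos_sign x S"
  by (simp add: pos_sign_def)

lemma pos_sign_square [simp]: "pos_sign x S * pos_sign x S = 1"
  by (simp add: pos_sign_def flip: prod.distrib)

lemma map_sign_empty [simp]: "map_sign f {} = 1"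
  by (simp add: map_sign_def)

text \<open>The new pairs are those of \<open>x\<close> with some \<open>z\<close> in
  \<open>S\<close>. The product lists them in increasing order, and \<open>pair_sign x z\<close>
  compensates for turning a pair around when \<open>z < x\<close>.\<close>

lemma map_sign_insert:
  assumes "finite S" "x \<notin> S" "inj_on f (insert x S)"
  shows "map_sign f (insert x S) = map_sign f S * pos_sign x S * pos_sign (f x) (f ` S)"
proof -
  define U where "U = {z \<in> S. x < z}"
  define L where "L = {z \<in> S. z < x}"
  have fin: "finite U" "finite L" and S: "S = U \<union> L" "U \<inter> L = {}"
    using assms(1,2) by (auto simp: U_def L_def) (metis linorder_neqE)
  have inj: "f z \<noteq> f x" if "z \<in> S" for z
    using assms(2,3) that by (metis inj_onD insertI1 insertI2)
  have fin': "finite {(x, y). x \<in> S \<and> y \<in> S \<and> x < y}"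
    by (rule finite_subset[of _ "S \<times> S"]) (use assms(1) in auto)
  have split: "{(a, b). a \<in> insert x S \<and> b \<in> insert x S \<and> a < b} =
    {(a, b). a \<in> S \<and> b \<in> S \<and> a < b} \<union> (Pair x ` U \<union> (\<lambda>z. (z, x)) ` L)"
    by (auto simp: U_def L_def)
  have "map_sign f (insert x S) =
      map_sign f S * (\<Prod>(a, b)\<in>Pair x ` U \<union> (\<lambda>z. (z, x)) ` L. pair_sign (f a) (f b))"
    unfolding map_sign_def split
    by (rule prod.union_disjoint) (use fin fin' assms(2) in auto)
  also have "(\<Prod>(a, b)\<in>Pair x ` U \<union> (\<lambda>z. (z, x)) ` L. pair_sign (f a) (f b)) =
      (\<Prod>(a, b)\<in>Pair x ` U. pair_sign (f a) (f b)) *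
      (\<Prod>(a, b)\<in>(\<lambda>z. (z, x)) ` L. pair_sign (f a) (f b))"
    by (rule prod.union_disjoint) (use fin in \<open>auto simp: U_def L_def\<close>)
  also have "(\<Prod>(a, b)\<in>Pair x ` U. pair_sign (f a) (f b)) = (\<Prod>z\<in>U. pair_sign x z * pair_sign (f x) (f z))"
    by (subst prod.reindex) (auto simp: inj_on_def U_def pair_sign_def intro!: prod.cong)
  also have "(\<Prod>(a, b)\<in>(\<lambda>z. (z, x)) ` L. pair_sign (f a) (f b)) =
      (\<Prod>z\<in>L. pair_sign x z * pair_sign (f x) (f z))"
    by (subst prod.reindex)
       (use inj in \<open>auto simp: inj_on_def L_def pair_sign_def intro!: prod.cong\<close>)
  also have "(\<Prod>z\<in>U. pair_sign x z * pair_sign (f x) (f z)) *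
      (\<Prod>z\<in>L. pair_sign x z * pair_sign (f x) (f z)) = (\<Prod>z\<in>S. pair_sign x z * pair_sign (f x) (f z))"
    unfolding S(1) by (rule prod.union_disjoint[OF fin S(2), symmetric])
  also have "\<dots> = pos_sign x S * pos_sign (f x) (f ` S)"
    using assms(3) by (simp add: pos_sign_def prod.distrib prod.reindex)
  finally show ?thesis by (simp add: mult.assoc)
qed

lemma map_sign_square [simp]: "map_sign f S * map_sign f S = 1"
  unfolding map_sign_def prod.distrib[symmetric]
  by (rule prod.neutral) auto

text \<open>Induction on \<open>C\<close> by \<open>map_sign_insert\<close>. The point is that the
  mixed factor depends on \<open>f\<close> only through the images of \<open>S\<close> and
  \<open>C\<close>.\<close>

lemma map_sign_Un:
  assumes "finite S" "finite C" "S \<inter> C = {}" "inj_on f (S \<union> C)"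
  shows "map_sign f (S \<union> C) = map_sign f S * map_sign f C *
    ((\<Prod>x\<in>C. pos_sign x S) * (\<Prod>y\<in>f ` C. pos_sign y (f ` S)))"
  using assms(2,1,3,4)
proof (induction C rule: finite_induct)
  case empty
  then show ?case by simp
next
  case (insert x C)
  have inj: "inj_on f (insert x (S \<union> C))" "inj_on f (insert x C)" "inj_on f (S \<union> C)"
    "f x \<notin> f ` C" "f x \<notin> f ` S" "f ` S \<inter> f ` C = {}"
    using insert.prems(2,3) insert.hyps by (auto simp: inj_on_def)
  have un: "pos_sign z (P \<union> Q) = pos_sign z P * pos_sign z Q"
    if "finite P" "finite Q" "P \<inter> Q = {}" for z :: "'c::linorder" and P Q
    using that by (simp add: pos_sign_def prod.union_disjoint)
  have "map_sign f (S \<union> insert x C) = map_sign f (S \<union> C) * pos_sign x (S \<union> C) * pos_sign (f x) (f ` (S \<union> C))"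
    using map_sign_insert[of "S \<union> C" x f] insert.hyps insert.prems inj by simp
  also have "\<dots> = map_sign f (S \<union> C) * (pos_sign x S * pos_sign x C) *
      (pos_sign (f x) (f ` S) * pos_sign (f x) (f ` C))"
    using insert.hyps insert.prems inj by (simp add: un image_Un)
  finally show ?case
    using insert inj by (simp add: map_sign_insert mult_ac)
qed

section \<open>Creation and annihilation operators\<close>

text \<open>
  A function on the finite subsets of a linear order stands for the element \<open>\<Sum>S. v S e\<^sub>S\<close> of the exterior
  algebra, where \<open>e\<^sub>S\<close> is the wedge product of \<open>S\<close> in a fixed order. The operator
  \<open>boundary X\<close> is the contraction with the vector of ones, and \<open>coboundary X\<close> is its adjoint.
\<close>

definition annihilate :: "'a::linorder \<Rightarrow> ('a set \<Rightarrow> real) \<Rightarrow> 'a set \<Rightarrow> real" where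
  "annihilate x v S = (if x \<in> S then 0 else pos_sign x S * v (insert x S))"

definition create :: "'a::linorder \<Rightarrow> ('a set \<Rightarrow> real) \<Rightarrow> 'a set \<Rightarrow> real" where
  "create x v S = (if x \<in> S then pos_sign x (S - {x}) * v (S - {x}) else 0)"

definition boundary :: "'a::linorder set \<Rightarrow> ('a set \<Rightarrow> real) \<Rightarrow> 'a set \<Rightarrow> real" where
  "boundary X v S = (\<Sum>x\<in>X. annihilate x v S)"

definition coboundary :: "'a::linorder set \<Rightarrow> ('a set \<Rightarrow> real) \<Rightarrow> 'a set \<Rightarrow> real" where
  "coboundary X v S = (\<Sum>x\<in>X. create x v S)"

definition pow_inner :: "'a set \<Rightarrow> ('a set \<Rightarrow> real) \<Rightarrow> ('a set \<Rightarrow> real) \<Rightarrow> real" where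
  "pow_inner X v w = (\<Sum>S\<in>Pow X. v S * w S)"

text \<open>The canonical anticommutation relation. For distinct \<open>x\<close> and
  \<open>y\<close> the two orders of operation differ by the sign of exchanging e_x and e_y; for
  \<open>x = y\<close> exactly one of the two terms survives.\<close>

lemma annihilate_create:
  assumes "finite S"
  shows "annihilate x (create y v) S + create y (annihilate x v) S = (if x = y then v S else 0)"
proof (cases "x = y")
  case True
  then show ?thesis
    by (auto simp: annihilate_def create_def insert_absorb)
next
  case False
  show ?thesis
  proof (cases "x \<in> S \<or> y \<notin> S")
    case True
    with False show ?thesis
      by (auto simp: annihilate_def create_def)
  next
    case xy: False
    define R where "R = S - {y}"
    have R: "S = insert y R" "x \<notin> R" "y \<notin> R" "finite R"
      using xy assms by (auto simp: R_def)
    have "insert x (insert y R) - {y} = insert x R"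
      using False R by auto
    then show ?thesis
      using False R pair_sign_swap[OF False] by (simp add: annihilate_def create_def)
  qed
qed

lemma annihilate_swap:
  assumes "finite S"
  shows "annihilate x (annihilate y v) S = - annihilate y (annihilate x v) S"
  using assms pair_sign_swap[of x y]
  by (cases "x = y") (auto simp: annihilate_def insert_commute)

lemma annihilate_sum: "annihilate x (\<lambda>S. \<Sum>i\<in>F. w i S) S = (\<Sum>i\<in>F. annihilate x (w i) S)"
  by (simp add: annihilate_def sum_distrib_left)

lemma create_sum: "create x (\<lambda>S. \<Sum>i\<in>F. w i S) S = (\<Sum>i\<in>F. create x (w i) S)"
  by (simp add: create_def sum_distrib_left)

lemma annihilate_boundary:
  assumes "finite S"
  shows "annihilate x (boundary X v) S = - boundary X (annihilate x v) S"
proof -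
  have "annihilate x (boundary X v) S = (\<Sum>y\<in>X. annihilate x (annihilate y v) S)"
    by (simp add: boundary_def[abs_def] annihilate_sum)
  then show ?thesis
    by (simp add: boundary_def annihilate_swap[OF assms, of x] sum_negf)
qed

text \<open>The terms \<open>annihilate x (annihilate y v)\<close> are antisymmetric in
  \<open>x\<close> and \<open>y\<close>, so their double sum is its own negative.\<close>

lemma boundary_boundary [simp]:
  assumes "finite S"
  shows "boundary X (boundary X v) S = 0"
proof -
  have "boundary X (boundary X v) S = (\<Sum>x\<in>X. \<Sum>y\<in>X. annihilate x (annihilate y v) S)"
    by (simp add: boundary_def[abs_def] annihilate_sum)
  moreover have "(\<Sum>x\<in>X. \<Sum>y\<in>X. annihilate x (annihilate y v) S) =
      - (\<Sum>x\<in>X. \<Sum>y\<in>X. annihilate x (annihilate y v) S)"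
    by (subst sum.swap) (subst annihilate_swap[OF assms], simp add: sum_negf)
  ultimately show ?thesis by simp
qed

lemma annihilate_coboundary:
  assumes "finite S" "finite X"
  shows "annihilate x (coboundary X v) S + coboundary X (annihilate x v) S = (if x \<in> X then v S else 0)"
proof -
  have "annihilate x (coboundary X v) S = (\<Sum>y\<in>X. annihilate x (create y v) S)"
    by (simp add: coboundary_def[abs_def] annihilate_sum)
  then show ?thesis
    using assms by (simp add: coboundary_def annihilate_create flip: sum.distrib)
qed

lemma boundary_create:
  assumes "finite S" "finite X"
  shows "boundary X (create y v) S + create y (boundary X v) S = (if y \<in> X then v S else 0)"
proof -
  have "create y (boundary X v) S = (\<Sum>x\<in>X. create y (annihilate x v) S)"
    by (simp add: boundary_def[abs_def] create_sum)
  then show ?thesis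
    using assms by (simp add: boundary_def annihilate_create flip: sum.distrib)
qed

text \<open>Only the diagonal anticommutators survive the summation, so the Laplacian of the full
  simplex is a scalar. This makes the projections used below explicit.\<close>

lemma boundary_coboundary:
  assumes "finite S" "finite X"
  shows "boundary X (coboundary X v) S + coboundary X (boundary X v) S = real (card X) * v S"
proof -
  have *: "coboundary X (boundary X v) S = (\<Sum>x\<in>X. coboundary X (annihilate x v) S)"
    unfolding coboundary_def boundary_def[abs_def] create_sum by (rule sum.swap)
  have "boundary X (coboundary X v) S + coboundary X (boundary X v) S =
     (\<Sum>x\<in>X. annihilate x (coboundary X v) S + coboundary X (annihilate x v) S)"
    unfolding * sum.distrib by (simp add: boundary_def)
  also have "\<dots> = (\<Sum>x\<in>X. v S)"
    by (rule sum.cong) (use assms in \<open>simp_all add: annihilate_coboundary\<close>)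
  finally show ?thesis by simp
qed

lemma pow_inner_commute: "pow_inner X v w = pow_inner X w v"
  by (simp add: pow_inner_def mult.commute)

lemma pow_inner_cong:
  assumes "\<And>S. S \<subseteq> X \<Longrightarrow> v S = v' S" "\<And>S. S \<subseteq> X \<Longrightarrow> w S = w' S"
  shows "pow_inner X v w = pow_inner X v' w'"
  using assms by (auto simp: pow_inner_def intro!: sum.cong)

lemma sum_Pow_remove:
  fixes f :: "'a set \<Rightarrow> real"
  assumes "finite X" "x \<in> X"
  shows "(\<Sum>S\<in>Pow X. f S) = (\<Sum>S\<in>Pow (X - {x}). f S) + (\<Sum>S\<in>Pow (X - {x}). f (insert x S))"
proof -
  have X: "X = insert x (X - {x})" using assms by auto
  have "sum f (Pow X) = sum f (Pow (X - {x}) \<union> insert x ` Pow (X - {x}))"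
    using Pow_insert[of x "X - {x}"] X by simp
  also have "\<dots> = sum f (Pow (X - {x})) + sum f (insert x ` Pow (X - {x}))"
    by (rule sum.union_disjoint) (use assms in auto)
  also have "sum f (insert x ` Pow (X - {x})) = (\<Sum>S\<in>Pow (X - {x}). f (insert x S))"
    by (subst sum.reindex) (auto simp: inj_on_def)
  finally show ?thesis .
qed

lemma pow_inner_annihilate:
  assumes "finite X" "x \<in> X"
  shows "pow_inner X (annihilate x v) w = pow_inner X v (create x w)"
proof -
  have "\<And>S. S \<subseteq> X - {x} \<Longrightarrow> x \<notin> S" by auto
  then show ?thesis
    using assms unfolding pow_inner_def sum_Pow_remove[OF assms]
    by (auto simp: annihilate_def create_def intro!: sum.cong)
qed

lemma pow_inner_sum_left:
  "pow_inner X (\<lambda>S. \<Sum>i\<in>F. c i * w i S) v = (\<Sum>i\<in>F. c i * pow_inner X (w i) v)"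
  unfolding pow_inner_def
  by (simp add: sum_distrib_left sum_distrib_right mult.assoc) (rule sum.swap)

lemma pow_inner_sum_right:
  "pow_inner X v (\<lambda>S. \<Sum>i\<in>F. c i * w i S) = (\<Sum>i\<in>F. c i * pow_inner X v (w i))"
  by (simp add: pow_inner_commute[of X v] pow_inner_sum_left)

lemma pow_inner_boundary:
  assumes "finite X"
  shows "pow_inner X (boundary X v) w = pow_inner X v (coboundary X w)"
proof -
  have "pow_inner X (boundary X v) w = (\<Sum>x\<in>X. pow_inner X (annihilate x v) w)"
    using pow_inner_sum_left[where X = X and F = X and c = "\<lambda>_. 1" and w = "\<lambda>x. annihilate x v" and v = w] by (simp add: boundary_def[abs_def])
  also have "\<dots> = (\<Sum>x\<in>X. pow_inner X v (create x w))"
    using assms by (simp add: pow_inner_annihilate)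
  also have "\<dots> = pow_inner X v (coboundary X w)"
    using pow_inner_sum_right[where X = X and F = X and c = "\<lambda>_. 1" and w = "\<lambda>x. create x w" and v = v] by (simp add: coboundary_def[abs_def])
  finally show ?thesis .
qed

text \<open>The transpose of the action of \<open>\<Sum>p\<in>A. p\<close>, which avoids inverses of the maps \<open>p\<close>.\<close>

definition pull :: "('a::linorder \<Rightarrow> 'b::linorder) set \<Rightarrow> ('b set \<Rightarrow> real) \<Rightarrow> 'a set \<Rightarrow> real" where
  "pull A v S = (\<Sum>p\<in>A. map_sign p S * v (p ` S))"

lemma pull_sum: "pull A (\<lambda>S. \<Sum>i\<in>F. c i * w i S) S = (\<Sum>i\<in>F. c i * pull A (w i) S)"
  unfolding pull_def sum_distrib_left
  by (subst sum.swap) (simp add: mult_ac)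

lemma pull_one_annihilate:
  assumes "inj_on p X" "x \<in> X" "S \<subseteq> X" "finite X"
  shows "map_sign p S * annihilate (p x) v (p ` S) = annihilate x (\<lambda>S. map_sign p S * v (p ` S)) S"
proof (cases "x \<in> S")
  case True
  then show ?thesis by (simp add: annihilate_def)
next
  case False
  have inj: "inj_on p (insert x S)"
    by (rule inj_on_subset[OF assms(1)]) (use assms in auto)
  then have "p x \<notin> p ` S"
    using False by auto
  moreover have "finite S"
    using assms finite_subset by blast
  ultimately show ?thesis
    using False inj by (simp add: annihilate_def map_sign_insert mult_ac)
qed

lemma pull_one_create:
  assumes "inj_on p X" "x \<in> X" "S \<subseteq> X" "finite X"
  shows "map_sign p S * create (p x) v (p ` S) = create x (\<lambda>S. map_sign p S * v (p ` S)) S"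
proof (cases "x \<in> S")
  case False
  then have "p x \<notin> p ` S"
    using assms by (auto simp: inj_on_def)
  with False show ?thesis by (simp add: create_def)
next
  case True
  define R where "R = S - {x}"
  have R: "S = insert x R" "x \<notin> R" "finite R"
    using True assms by (auto simp: R_def intro: finite_subset)
  then have inj: "inj_on p (insert x R)"
    using assms(1,3) inj_on_subset by blast
  then have "p x \<notin> p ` R"
    using R by auto
  with R inj show ?thesis
    by (simp add: create_def map_sign_insert mult_ac)
qed

text \<open>Bijections preserve the vector of ones, so contraction with it is compatible with the
  action of every \<open>p\<close>.\<close>

lemma pull_boundary:
  assumes "\<And>p. p \<in> A \<Longrightarrow> bij_betw p X Y" "S \<subseteq> X" "finite X"
  shows "pull A (boundary Y v) S = boundary X (pull A v) S"
proof -
  have "map_sign p S * boundary Y v (p ` S) = (\<Sum>x\<in>X. annihilate x (\<lambda>S. map_sign p S * v (p ` S)) S)"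
    if "p \<in> A" for p
  proof -
    have "boundary Y v (p ` S) = (\<Sum>x\<in>X. annihilate (p x) v (p ` S))"
      unfolding boundary_def by (rule sum.reindex_bij_betw[OF assms(1)[OF that], symmetric])
    then show ?thesis
      using pull_one_annihilate[of p X _ S v] assms that bij_betw_imp_inj_on[of p X Y]
      by (simp add: sum_distrib_left)
  qed
  then have "pull A (boundary Y v) S = (\<Sum>p\<in>A. \<Sum>x\<in>X. annihilate x (\<lambda>S. map_sign p S * v (p ` S)) S)"
    by (simp add: pull_def)
  also have "\<dots> = boundary X (pull A v) S"
    unfolding boundary_def pull_def[abs_def]
    by (subst sum.swap) (simp add: annihilate_sum)
  finally show ?thesis .
qed

lemma pull_coboundary:
  assumes "\<And>p. p \<in> A \<Longrightarrow> bij_betw p X Y" "S \<subseteq> X" "finite X"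
  shows "pull A (coboundary Y v) S = coboundary X (pull A v) S"
proof -
  have "map_sign p S * coboundary Y v (p ` S) = (\<Sum>x\<in>X. create x (\<lambda>S. map_sign p S * v (p ` S)) S)"
    if "p \<in> A" for p
  proof -
    have "coboundary Y v (p ` S) = (\<Sum>x\<in>X. create (p x) v (p ` S))"
      unfolding coboundary_def by (rule sum.reindex_bij_betw[OF assms(1)[OF that], symmetric])
    then show ?thesis
      using pull_one_create[of p X _ S v] assms that bij_betw_imp_inj_on[of p X Y]
      by (simp add: sum_distrib_left)
  qed
  then have "pull A (coboundary Y v) S = (\<Sum>p\<in>A. \<Sum>x\<in>X. create x (\<lambda>S. map_sign p S * v (p ` S)) S)"
    by (simp add: pull_def)
  also have "\<dots> = coboundary X (pull A v) S"
    unfolding coboundary_def pull_def[abs_def]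
    by (subst sum.swap) (simp add: create_sum)
  finally show ?thesis .
qed

text \<open>Each \<open>p\<close> in \<open>A\<close> takes the value \<open>y\<close> at exactly
  one \<open>x\<close>, which sorts \<open>A\<close> into fibres. This is how the restricted
  families enter the branching inequality.\<close>

lemma pull_create:
  assumes "\<And>p. p \<in> A \<Longrightarrow> bij_betw p X Y" "S \<subseteq> X" "finite X" "finite A" "y \<in> Y"
  shows "pull A (create y v) S = (\<Sum>x\<in>X. create x (pull {p\<in>A. p x = y} v) S)"
proof -
  have "map_sign p S * create y v (p ` S) =
      (\<Sum>x\<in>X. if p x = y then create x (\<lambda>S. map_sign p S * v (p ` S)) S else 0)"
    if "p \<in> A" for p
  proof -
    have bij: "bij_betw p X Y" using assms(1) that .
    then obtain x where x: "x \<in> X" "p x = y"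
      using assms(5) by (auto simp: bij_betw_def)
    have "(\<Sum>x\<in>X. if p x = y then create x (\<lambda>S. map_sign p S * v (p ` S)) S else 0) =
        (\<Sum>z\<in>X. if z = x then create x (\<lambda>S. map_sign p S * v (p ` S)) S else 0)"
      using x bij by (intro sum.cong) (auto simp: bij_betw_def inj_on_def)
    then show ?thesis
      using pull_one_create[of p X x S v] x bij assms(2,3) by (simp add: bij_betw_def)
  qed
  then have "pull A (create y v) S =
      (\<Sum>p\<in>A. \<Sum>x\<in>X. if p x = y then create x (\<lambda>S. map_sign p S * v (p ` S)) S else 0)"
    by (simp add: pull_def)
  also have "\<dots> = (\<Sum>x\<in>X. \<Sum>p\<in>{p\<in>A. p x = y}. create x (\<lambda>S. map_sign p S * v (p ` S)) S)"
    by (subst sum.swap) (use assms(4) in \<open>simp add: sum.inter_filter\<close>)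
  also have "\<dots> = (\<Sum>x\<in>X. create x (pull {p\<in>A. p x = y} v) S)"
    by (simp add: pull_def[abs_def] create_sum)
  finally show ?thesis .
qed

section \<open>Exterior powers of the standard representation\<close>

definition unit_vec :: "'a set \<Rightarrow> 'a set \<Rightarrow> real" where
  "unit_vec T S = (if S = T then 1 else 0)"

definition layer :: "'a set \<Rightarrow> nat \<Rightarrow> 'a set set" where
  "layer Y j = {T. T \<subseteq> Y \<and> card T = j}"

text \<open>Bilinear in two families, so that squared norms (\<open>A = B\<close>) can be expanded
  into traces attached to pairs of single maps.\<close>

definition pull_form where
  "pull_form A B X v w = pow_inner X (pull A v) (pull B w)"

definition bij_family :: "'a set \<Rightarrow> 'b set \<Rightarrow> ('a \<Rightarrow> 'b) set \<Rightarrow> bool" where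
  "bij_family X Y A \<longleftrightarrow> finite X \<and> finite Y \<and> card X = card Y \<and> finite A \<and> (\<forall>p\<in>A. bij_betw p X Y)"

text \<open>The Hilbert-Schmidt inner product of the operators of \<open>A\<close> and
  \<open>B\<close> on the \<open>j\<close>-th exterior power of the permutation
  representation.\<close>

definition ext_form where
  "ext_form X Y j A B = (\<Sum>T\<in>layer Y j. pull_form A B X (unit_vec T) (unit_vec T))"

text \<open>
  The \<open>j\<close>-th exterior power of the standard representation is the image of the boundary in degree \<open>j\<close>,
  and the boundary is \<open>sqrt (card Y)\<close> times a partial isometry.
\<close>

definition std_form where
  "std_form X Y j A B = (\<Sum>T\<in>layer Y (Suc j).
     pull_form A B X (boundary Y (unit_vec T)) (boundary Y (unit_vec T))) / card Y"

lemma finite_layer [simp]: "finite Y \<Longrightarrow> finite (layer Y j)"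
  by (simp add: layer_def)

lemma sum_unit_vec:
  assumes "finite F"
  shows "(\<Sum>T\<in>F. f T * unit_vec T S) = (if S \<in> F then f S else 0)"
  using assms by (simp add: unit_vec_def if_distrib cong: if_cong)

lemma boundary_sum: "boundary X (\<lambda>S. \<Sum>i\<in>F. c i * w i S) S = (\<Sum>i\<in>F. c i * boundary X (w i) S)"
proof -
  have "annihilate x (\<lambda>S. \<Sum>i\<in>F. c i * w i S) S = (\<Sum>i\<in>F. c i * annihilate x (w i) S)" for x
    by (simp add: annihilate_def sum_distrib_left mult_ac)
  then show ?thesis
    unfolding boundary_def by (simp add: sum_distrib_left) (rule sum.swap)
qed

lemma boundary_cong:
  assumes "\<And>S. S \<subseteq> X \<Longrightarrow> v S = w S" "S \<subseteq> X"
  shows "boundary X v S = boundary X w S"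
  using assms by (auto simp: boundary_def annihilate_def intro!: sum.cong)

lemma boundary_unit_vec_nonzero:
  assumes "boundary Y (unit_vec T) S \<noteq> 0"
  shows "\<exists>x\<in>Y. x \<notin> S \<and> T = insert x S"
proof -
  obtain x where x: "x \<in> Y" "annihilate x (unit_vec T) S \<noteq> 0"
    using assms unfolding boundary_def by (meson sum.neutral)
  then show ?thesis
    by (auto simp: annihilate_def unit_vec_def split: if_splits)
qed

lemma boundary_unit_vec_layer:
  assumes "boundary Y (unit_vec T) S \<noteq> 0" "finite S"
  shows "card T = Suc (card S)"
  using boundary_unit_vec_nonzero[OF assms(1)] assms(2) by auto

lemma pow_inner_unit_vec:
  assumes "finite X" "T \<subseteq> X"
  shows "pow_inner X (unit_vec T) v = v T"
  using assms by (simp add: pow_inner_def unit_vec_def of_bool_def flip: of_bool_def)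

lemma coboundary_unit_vec:
  assumes "finite Y" "T \<subseteq> Y" "S \<subseteq> Y"
  shows "coboundary Y (unit_vec T) S = boundary Y (unit_vec S) T"
proof -
  have "coboundary Y (unit_vec T) S = pow_inner Y (unit_vec S) (coboundary Y (unit_vec T))"
    using assms by (simp add: pow_inner_unit_vec)
  also have "\<dots> = boundary Y (unit_vec S) T"
    using assms by (simp add: pow_inner_unit_vec pow_inner_commute flip: pow_inner_boundary)
  finally show ?thesis .
qed

lemma pull_cong:
  assumes "bij_family X Y A" "\<And>T. T \<subseteq> Y \<Longrightarrow> v T = w T" "S \<subseteq> X"
  shows "pull A v S = pull A w S"
proof -
  have "p ` S \<subseteq> Y" if "p \<in> A" for p
    using assms(1,3) that by (auto simp: bij_family_def bij_betw_def)
  then show ?thesis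
    using assms(2) by (auto simp: pull_def intro!: sum.cong)
qed

lemma pull_form_cong:
  assumes "bij_family X Y A" "bij_family X Y B"
    "\<And>T. T \<subseteq> Y \<Longrightarrow> v T = v' T" "\<And>T. T \<subseteq> Y \<Longrightarrow> w T = w' T"
  shows "pull_form A B X v w = pull_form A B X v' w'"
  unfolding pull_form_def
  by (intro pow_inner_cong pull_cong[OF assms(1)] pull_cong[OF assms(2)] assms(3,4))

lemma pull_form_sum_left:
  "pull_form A B X (\<lambda>S. \<Sum>i\<in>F. c i * v i S) w = (\<Sum>i\<in>F. c i * pull_form A B X (v i) w)"
  unfolding pull_form_def pull_sum[abs_def] by (rule pow_inner_sum_left)

lemma pull_form_sum_right:
  "pull_form A B X v (\<lambda>S. \<Sum>i\<in>F. c i * w i S) = (\<Sum>i\<in>F. c i * pull_form A B X v (w i))"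
  unfolding pull_form_def pull_sum[abs_def] by (rule pow_inner_sum_right)

lemma pull_form_boundary:
  assumes "bij_family X Y A" "bij_family X Y B"
  shows "pull_form A B X (boundary Y v) w = pull_form A B X v (coboundary Y w)"
proof -
  have "pull_form A B X (boundary Y v) w = pow_inner X (boundary X (pull A v)) (pull B w)"
    unfolding pull_form_def
    by (rule pow_inner_cong) (use assms pull_boundary[of A X Y] in \<open>auto simp: bij_family_def\<close>)
  also have "\<dots> = pow_inner X (pull A v) (coboundary X (pull B w))"
    using assms by (simp add: pow_inner_boundary bij_family_def)
  also have "\<dots> = pull_form A B X v (coboundary Y w)"
    unfolding pull_form_def
    by (rule pow_inner_cong) (use assms pull_coboundary[of B X Y] in \<open>auto simp: bij_family_def\<close>)
  finally show ?thesis .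
qed

text \<open>Cyclicity of the trace, with the boundary moved from one end of the product of operators
  to the other. The matrix of the coboundary is the transpose of that of the boundary; after
  expansion in unit vectors the two sums are exchanged.\<close>

lemma sum_layer_boundary_coboundary:
  assumes "bij_family X Y A" "bij_family X Y B"
  shows "(\<Sum>T\<in>layer Y j. pull_form A B X (unit_vec T) (boundary Y (coboundary Y (unit_vec T)))) =
    (\<Sum>T\<in>layer Y (Suc j). pull_form A B X (boundary Y (unit_vec T)) (boundary Y (unit_vec T)))"
proof -
  have fin: "finite Y"
    using assms by (simp add: bij_family_def)
  have layer_D: "finite T" "T \<subseteq> Y" "card T = k" if "T \<in> layer Y k" for T k
    using that fin by (auto simp: layer_def intro: finite_subset)
  let ?c = "\<lambda>T' T. boundary Y (unit_vec T') T"
  have "pull_form A B X (unit_vec T) (boundary Y (coboundary Y (unit_vec T))) =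
      (\<Sum>T'\<in>layer Y (Suc j). ?c T' T * pull_form A B X (unit_vec T) (boundary Y (unit_vec T')))"
    if T: "T \<in> layer Y j" for T
  proof -
    have co: "coboundary Y (unit_vec T) S = (\<Sum>T'\<in>layer Y (Suc j). ?c T' T * unit_vec T' S)" if S: "S \<subseteq> Y" for S
    proof -
      have "coboundary Y (unit_vec T) S = ?c S T"
        using S layer_D[OF T] fin by (simp add: coboundary_unit_vec)
      moreover have "?c S T = 0" if "S \<notin> layer Y (Suc j)"
        using that S layer_D[OF T] boundary_unit_vec_layer[of Y S T] by (auto simp: layer_def)
      ultimately show ?thesis
        using fin by (simp add: sum_unit_vec)
    qed
    have "boundary Y (coboundary Y (unit_vec T)) S =
        (\<Sum>T'\<in>layer Y (Suc j). ?c T' T * boundary Y (unit_vec T') S)" if "S \<subseteq> Y" for S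
      unfolding boundary_sum[symmetric] by (rule boundary_cong[OF co that])
    then show ?thesis
      unfolding pull_form_sum_right[symmetric] by (intro pull_form_cong[OF assms] refl)
  qed
  then have "(\<Sum>T\<in>layer Y j. pull_form A B X (unit_vec T) (boundary Y (coboundary Y (unit_vec T)))) =
      (\<Sum>T'\<in>layer Y (Suc j). \<Sum>T\<in>layer Y j. ?c T' T * pull_form A B X (unit_vec T) (boundary Y (unit_vec T')))"
    by (subst sum.swap) simp
  also have "\<dots> = (\<Sum>T'\<in>layer Y (Suc j). pull_form A B X (boundary Y (unit_vec T')) (boundary Y (unit_vec T')))"
  proof (rule sum.cong[OF refl])
    fix T' assume T': "T' \<in> layer Y (Suc j)"
    have "?c T' S = (\<Sum>T\<in>layer Y j. ?c T' T * unit_vec T S)" if S: "S \<subseteq> Y" for S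
    proof -
      have "?c T' S = 0" if "S \<notin> layer Y j"
        using that S layer_D[OF T'] boundary_unit_vec_layer[of Y T' S] finite_subset[OF S fin]
        by (auto simp: layer_def)
      then show ?thesis
        using fin by (simp add: sum_unit_vec)
    qed
    then show "(\<Sum>T\<in>layer Y j. ?c T' T * pull_form A B X (unit_vec T) (boundary Y (unit_vec T'))) =
        pull_form A B X (boundary Y (unit_vec T')) (boundary Y (unit_vec T'))"
      unfolding pull_form_sum_left[symmetric] by (intro pull_form_cong[OF assms] refl) simp
  qed
  finally show ?thesis .
qed

text \<open>The scalar Laplacian splits each diagonal entry into two terms. Adjointness rewrites the
  one in which the boundary is applied first; cyclicity of the trace moves the other up one
  degree.\<close>

lemma ext_form_expand:
  assumes "bij_family X Y A" "bij_family X Y B"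
  shows "card Y * ext_form X Y j A B =
    (\<Sum>T\<in>layer Y (Suc j). pull_form A B X (boundary Y (unit_vec T)) (boundary Y (unit_vec T))) +
    (\<Sum>T\<in>layer Y j. pull_form A B X (boundary Y (unit_vec T)) (boundary Y (unit_vec T)))"
proof -
  have fin: "finite Y"
    using assms by (simp add: bij_family_def)
  have "card Y * pull_form A B X (unit_vec T) (unit_vec T) =
      pull_form A B X (unit_vec T) (boundary Y (coboundary Y (unit_vec T))) +
      pull_form A B X (boundary Y (unit_vec T)) (boundary Y (unit_vec T))" for T
  proof -
    \<comment> \<open>Scalar multiples and sums of two vectors are written as sums over
      \<open>{()}\<close> and \<open>{True, False}\<close>, so that
      \<open>pull_form_sum_right\<close> covers both.\<close>
    have "card Y * pull_form A B X (unit_vec T) (unit_vec T) =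
        pull_form A B X (unit_vec T) (\<lambda>S. \<Sum>i\<in>{()}. card Y * unit_vec T S)"
      by (subst pull_form_sum_right) simp
    also have "\<dots> = pull_form A B X (unit_vec T) (\<lambda>S. \<Sum>b\<in>{True, False}. 1 *
        (if b then boundary Y (coboundary Y (unit_vec T)) else coboundary Y (boundary Y (unit_vec T))) S)"
      using fin boundary_coboundary[OF _ fin] finite_subset[OF _ fin]
      by (intro pull_form_cong[OF assms]) auto
    also have "\<dots> = pull_form A B X (unit_vec T) (boundary Y (coboundary Y (unit_vec T))) +
        pull_form A B X (unit_vec T) (coboundary Y (boundary Y (unit_vec T)))"
      by (subst pull_form_sum_right) simp
    finally show ?thesis
      by (simp add: pull_form_boundary[OF assms])
  qed
  then show ?thesis
    by (simp add: ext_form_def sum_distrib_left sum.distrib sum_layer_boundary_coboundary[OF assms])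
qed

text \<open>The permutation representation is the standard one plus a trivial one, so each of its
  exterior powers of positive degree is a sum of two consecutive exterior powers of the standard
  representation.\<close>

lemma ext_form_Suc:
  assumes "bij_family X Y A" "bij_family X Y B" "Y \<noteq> {}"
  shows "ext_form X Y (Suc j) A B = std_form X Y (Suc j) A B + std_form X Y j A B"
  using ext_form_expand[OF assms(1,2), of "Suc j"] assms
  by (simp add: std_form_def bij_family_def field_simps)

lemma ext_form_0:
  assumes "bij_family X Y A" "bij_family X Y B" "Y \<noteq> {}"
  shows "ext_form X Y 0 A B = std_form X Y 0 A B"
proof -
  have "boundary Y (unit_vec {}) = (\<lambda>S. 0)"
    using boundary_unit_vec_nonzero[of Y "{}"] by fastforce
  moreover have "layer Y 0 = {{}}"
    using assms finite_subset by (fastforce simp: layer_def bij_family_def)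
  ultimately show ?thesis
    using ext_form_expand[OF assms(1,2), of 0] assms
    by (simp add: std_form_def bij_family_def field_simps pull_form_def pow_inner_def pull_def)
qed

lemma std_form_nonneg: "std_form X Y j A A \<ge> 0"
  unfolding std_form_def pull_form_def pow_inner_def
  by (intro divide_nonneg_nonneg sum_nonneg) auto

section \<open>The branching inequality\<close>

lemma pow_inner_comb_left:
  "pow_inner X (\<lambda>S. a * v S + b * w S) u = a * pow_inner X v u + b * pow_inner X w u"
  by (simp add: pow_inner_def algebra_simps sum.distrib sum_distrib_left)

lemma pow_inner_comb_right:
  "pow_inner X u (\<lambda>S. a * v S + b * w S) = a * pow_inner X u v + b * pow_inner X u w"
  by (simp add: pow_inner_def algebra_simps sum.distrib sum_distrib_left)

lemma pow_inner_nonneg: "pow_inner X v v \<ge> 0"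
  by (simp add: pow_inner_def sum_nonneg)

lemma coboundary_eq_0:
  assumes "\<And>S. S \<subseteq> X \<Longrightarrow> v S = 0" "S \<subseteq> X"
  shows "coboundary X v S = 0"
proof -
  have "v (S - {x}) = 0" for x
    using assms by blast
  then show ?thesis
    by (auto simp: coboundary_def create_def intro: sum.neutral)
qed

text \<open>On the kernel of the boundary the scalar Laplacian reduces to the boundary after the
  coboundary.\<close>

lemma pow_inner_coboundary_boundary:
  assumes "finite X" "\<And>S. S \<subseteq> X \<Longrightarrow> boundary X q S = 0"
  shows "pow_inner X (coboundary X q) (coboundary X q) = card X * pow_inner X q q"
proof -
  have "coboundary X (boundary X q) S = 0" if "S \<subseteq> X" for S
    by (rule coboundary_eq_0[OF assms(2) that])
  then have *: "boundary X (coboundary X q) S = card X * q S" if "S \<subseteq> X" for S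
    using boundary_coboundary[of S X q] that assms(1) finite_subset by fastforce
  have "pow_inner X (coboundary X q) (coboundary X q) = pow_inner X (boundary X (coboundary X q)) q"
    using assms(1) by (simp add: pow_inner_boundary)
  also have "\<dots> = pow_inner X (\<lambda>S. card X * q S + 0 * q S) q"
    using * by (intro pow_inner_cong) auto
  finally show ?thesis
    by (simp only: pow_inner_comb_left)
qed

text \<open>
  \<open>r - coboundary X (boundary X r) / card X\<close> is the orthogonal projection of \<open>r\<close> to the kernel of
  the boundary, to which \<open>g\<close> belongs.
\<close>

lemma pow_inner_kernel_bound:
  assumes "finite X" "X \<noteq> {}" "\<And>S. S \<subseteq> X \<Longrightarrow> boundary X g S = 0"
  shows "pow_inner X g g \<ge> 2 * pow_inner X g r - pow_inner X r r +
    pow_inner X (boundary X r) (boundary X r) / card X"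
proof -
  define N where "N = real (card X)"
  define q where "q = boundary X r"
  define c where "c = coboundary X q"
  have N: "N > 0"
    using assms(1,2) by (simp add: N_def card_gt_0_iff)
  have bq: "boundary X q S = 0" if "S \<subseteq> X" for S
    using finite_subset[OF that assms(1)] by (simp add: q_def)
  have cc: "pow_inner X c c = N * pow_inner X q q"
    unfolding c_def N_def by (rule pow_inner_coboundary_boundary[OF assms(1) bq])
  have gc: "pow_inner X g c = 0"
    unfolding c_def pow_inner_boundary[OF assms(1), symmetric]
    using assms(3) by (simp add: pow_inner_def)
  have rc: "pow_inner X r c = pow_inner X q q"
    by (simp add: c_def q_def pow_inner_boundary[OF assms(1)])
  \<comment> \<open>The squared distance of \<open>g\<close> from the projected vector
    \<open>r - c / N\<close>. As \<open>g\<close> is orthogonal to the coboundary \<open>c\<close>,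
    the cross term only sees \<open>r\<close>.\<close>
  have "0 \<le> pow_inner X (\<lambda>S. 1 * g S + (-1) * (1 * r S + (-1 / N) * c S)) (\<lambda>S. 1 * g S + (-1) * (1 * r S + (-1 / N) * c S))"
    by (rule pow_inner_nonneg)
  also have "\<dots> = pow_inner X g g - 2 * pow_inner X g r + pow_inner X r r -
      2 * ((1 / N) * pow_inner X q q) + (1 / N) * ((1 / N) * (N * pow_inner X q q))"
    unfolding pow_inner_comb_left pow_inner_comb_right
      pow_inner_commute[of X c g] pow_inner_commute[of X c r] pow_inner_commute[of X r g] gc rc cc
    by (simp add: algebra_simps)
  also have "(1 / N) * (N * pow_inner X q q) = pow_inner X q q"
    using N by simp
  finally show ?thesis
    by (simp add: q_def N_def)
qed

section \<open>Degrees and the number operator\<close>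

definition homogeneous :: "'a set \<Rightarrow> nat \<Rightarrow> ('a set \<Rightarrow> real) \<Rightarrow> bool" where
  "homogeneous X j v \<longleftrightarrow> (\<forall>S\<subseteq>X. v S \<noteq> 0 \<longrightarrow> card S = j)"

lemma homogeneous_create:
  assumes "homogeneous X j v" "finite X" "x \<in> X"
  shows "homogeneous X (Suc j) (create x v)"
proof -
  have "card S = Suc j" if "S \<subseteq> X" "x \<in> S" "v (S - {x}) \<noteq> 0" for S
  proof -
    have "card (S - {x}) = j"
      using assms(1) that unfolding homogeneous_def by (meson Diff_subset subset_trans)
    then show ?thesis
      using that card_Suc_Diff1[of S x] finite_subset[OF that(1) assms(2)] by auto
  qed
  then show ?thesis
    by (auto simp: homogeneous_def create_def split: if_splits)
qed

lemma homogeneous_boundary: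
  assumes "homogeneous X (Suc j) v" "finite X"
  shows "homogeneous X j (boundary X v)"
  unfolding homogeneous_def
proof (intro allI impI)
  fix S assume S: "S \<subseteq> X" "boundary X v S \<noteq> 0"
  obtain x where x: "x \<in> X" "annihilate x v S \<noteq> 0"
    using S unfolding boundary_def by (meson sum.neutral)
  then have "x \<notin> S" "v (insert x S) \<noteq> 0"
    by (auto simp: annihilate_def split: if_splits)
  then show "card S = j"
    using assms(1)[unfolded homogeneous_def, rule_format, of "insert x S"] x(1) S(1)
      card_insert_disjoint[OF finite_subset[OF S(1) assms(2)]]
    by simp
qed

lemma homogeneous_sum:
  assumes "\<And>i. i \<in> F \<Longrightarrow> homogeneous X j (w i)"
  shows "homogeneous X j (\<lambda>S. \<Sum>i\<in>F. w i S)"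
  unfolding homogeneous_def
proof (intro allI impI)
  fix S assume S: "S \<subseteq> X" "(\<Sum>i\<in>F. w i S) \<noteq> 0"
  then obtain i where "i \<in> F" "w i S \<noteq> 0"
    by (meson sum.neutral)
  with assms S(1) show "card S = j"
    by (auto simp: homogeneous_def)
qed

lemma homogeneous_comb:
  "homogeneous X j v \<Longrightarrow> homogeneous X j w \<Longrightarrow> homogeneous X j (\<lambda>S. a * v S + b * w S)"
  unfolding homogeneous_def
proof (intro allI impI)
  fix S assume "\<forall>S\<subseteq>X. v S \<noteq> 0 \<longrightarrow> card S = j" "\<forall>S\<subseteq>X. w S \<noteq> 0 \<longrightarrow> card S = j"
    "S \<subseteq> X" "a * v S + b * w S \<noteq> 0"
  then show "card S = j"
    by (cases "v S = 0") auto
qed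

lemma homogeneous_pull:
  assumes "homogeneous Y j v" "bij_family X Y A"
  shows "homogeneous X j (pull A v)"
  unfolding homogeneous_def
proof (intro allI impI)
  fix S assume S: "S \<subseteq> X" "pull A v S \<noteq> 0"
  then obtain p where "p \<in> A" "map_sign p S * v (p ` S) \<noteq> 0"
    unfolding pull_def by (meson sum.neutral)
  then have p: "p \<in> A" "v (p ` S) \<noteq> 0"
    by auto
  have "bij_betw p X Y"
    using p assms(2) by (simp add: bij_family_def)
  then have "p ` S \<subseteq> Y" "inj_on p S"
    using S(1) inj_on_subset[of p X S] by (auto simp: bij_betw_def)
  then show "card S = j"
    using assms(1)[unfolded homogeneous_def, rule_format, of "p ` S"] p(2) card_image[of p S] by simp
qed

text \<open>\<open>create x (annihilate x u)\<close> keeps the entries of \<open>u\<close> at sets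
  containing \<open>x\<close>, so the sum over \<open>x\<close> counts each entry as often as its
  set has elements: this is the number operator.\<close>

lemma sum_pow_inner_annihilate:
  assumes "finite X" "homogeneous X j u"
  shows "(\<Sum>x\<in>X. pow_inner X (annihilate x u) (annihilate x u)) = j * pow_inner X u u"
proof -
  have "(\<Sum>x\<in>X. pow_inner X (annihilate x u) (annihilate x u)) =
      (\<Sum>x\<in>X. pow_inner X u (create x (annihilate x u)))"
    by (rule sum.cong) (simp_all add: pow_inner_annihilate assms(1))
  also have "\<dots> = (\<Sum>x\<in>X. \<Sum>S\<in>Pow X. if x \<in> S then u S * u S else 0)"
    unfolding pow_inner_def
    by (intro sum.cong refl) (auto simp: create_def annihilate_def insert_absorb)
  also have "\<dots> = (\<Sum>S\<in>Pow X. \<Sum>x\<in>X. if x \<in> S then u S * u S else 0)"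
    by (rule sum.swap)
  also have "\<dots> = (\<Sum>S\<in>Pow X. j * (u S * u S))"
  proof (rule sum.cong[OF refl])
    fix S assume S: "S \<in> Pow X"
    have "(\<Sum>x\<in>X. if x \<in> S then u S * u S else 0) = (\<Sum>x\<in>X \<inter> S. u S * u S)"
      by (rule sum.inter_restrict[OF assms(1), symmetric])
    also have "\<dots> = card S * (u S * u S)"
      using S by (simp add: Int_absorb1)
    finally show "(\<Sum>x\<in>X. if x \<in> S then u S * u S else 0) = j * (u S * u S)"
      using assms(2) S by (auto simp: homogeneous_def)
  qed
  finally show ?thesis
    by (simp add: pow_inner_def sum_distrib_left)
qed

lemma pow_inner_remove_annihilate:
  assumes "finite X" "x \<in> X"
  shows "pow_inner (X - {x}) v (annihilate x u) = pow_inner X v (annihilate x u)"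
  unfolding pow_inner_def sum_Pow_remove[OF assms] by (simp add: annihilate_def)

text \<open>Dropping \<open>x\<close> from the sum costs nothing, since \<open>annihilate x\<close>
  squares to zero; the sign comes from anticommutation.\<close>

lemma boundary_remove_annihilate:
  assumes "finite X" "x \<in> X" "finite S"
  shows "boundary (X - {x}) (annihilate x u) S = - annihilate x (boundary X u) S"
proof -
  have "boundary X (annihilate x u) S = annihilate x (annihilate x u) S + boundary (X - {x}) (annihilate x u) S"
    unfolding boundary_def using assms by (simp add: sum.remove)
  then show ?thesis
    using annihilate_boundary[of S x X u] annihilate_swap[of S x x u] assms by simp
qed

lemma bij_family_remove:
  assumes "bij_family X Y A" "x \<in> X" "y \<in> Y"
  shows "bij_family (X - {x}) (Y - {y}) {p\<in>A. p x = y}"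
proof -
  have "bij_betw p (X - {x}) (Y - {y})" if "p \<in> A" "p x = y" for p
  proof -
    have "bij_betw p X Y" using assms(1) that(1) by (simp add: bij_family_def)
    then show ?thesis
      using assms(2) that(2) by (auto simp: bij_betw_def inj_on_def)
  qed
  then show ?thesis
    using assms by (auto simp: bij_family_def)
qed

text \<open>
  The test vector \<open>u\<close> is \<open>p\<close> multiplied by the inverse of \<open>j + 1 - j / (n - 1) C B\<close>,
  with \<open>n = card X\<close>, \<open>B\<close> the boundary and \<open>C\<close> the coboundary.
\<close>

lemma sum_kernel_bound:
  fixes p :: "'a::linorder set \<Rightarrow> real"
  assumes "finite X" "Suc j < card X" "homogeneous X (Suc j) p"
    and ker: "\<And>x S. x \<in> X \<Longrightarrow> S \<subseteq> X - {x} \<Longrightarrow> boundary (X - {x}) (g x) S = 0"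
    and p: "\<And>S. S \<subseteq> X \<Longrightarrow> p S = (\<Sum>x\<in>X. create x (g x) S)"
  shows "(\<Sum>x\<in>X. pow_inner (X - {x}) (g x) (g x)) \<ge> pow_inner X p p / (j + 1) +
    j * pow_inner X (boundary X p) (boundary X p) / ((j + 1) * (real (card X) - 1 - j))"
proof -
  define n where "n = real (card X)"
  define d where "d = n - 1 - j"
  define a where "a = 1 / (real j + 1)"
  define b where "b = a * (j / d)"
  define q where "q = boundary X p"
  define c where "c = coboundary X q"
  define u where "u = (\<lambda>S. a * p S + b * c S)"
  define P where "P = pow_inner X p p"
  define R where "R = pow_inner X q q"
  have n: "n > 1" "d > 0"
    using assms(2) by (auto simp: n_def d_def)
  have bq: "boundary X q S = 0" if "S \<subseteq> X" for S
    using finite_subset[OF that assms(1)] by (simp add: q_def)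
  have cc: "pow_inner X c c = n * R"
    unfolding c_def n_def R_def by (rule pow_inner_coboundary_boundary[OF assms(1) bq])
  have pc: "pow_inner X p c = R"
    by (simp add: c_def q_def R_def pow_inner_boundary[OF assms(1)])
  have pu: "pow_inner X p u = a * P + b * R"
    unfolding u_def pow_inner_comb_right by (simp add: P_def pc)
  have uu: "pow_inner X u u = a * a * P + 2 * a * b * R + b * b * n * R"
    unfolding u_def pow_inner_comb_right pow_inner_comb_left
    by (simp add: P_def[symmetric] pc cc pow_inner_commute[of X c p] algebra_simps)
  \<comment> \<open>The boundary kills \<open>q\<close>, so by the Laplacian the boundary of
    \<open>c\<close> is \<open>n\<close> times \<open>q\<close>, and that of \<open>u\<close> is
    again a multiple of \<open>q\<close>.\<close>
  have bu: "boundary X u S = (a + b * n) * q S" if "S \<subseteq> X" for S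
  proof -
    have "boundary X u S = boundary X (\<lambda>S. \<Sum>i\<in>{True, False}. (if i then a else b) * (if i then p else c) S) S"
      by (simp add: u_def)
    also have "\<dots> = a * q S + b * boundary X c S"
      by (subst boundary_sum) (simp add: q_def)
    also have "boundary X c S = n * q S"
    proof -
      have "coboundary X (boundary X q) S = 0"
        by (rule coboundary_eq_0[OF bq that])
      then show ?thesis
        using boundary_coboundary[of S X q] finite_subset[OF that] assms(1) by (simp add: c_def n_def)
    qed
    finally show ?thesis by (simp add: algebra_simps)
  qed
  have hom_q: "homogeneous X j q"
    unfolding q_def by (rule homogeneous_boundary[OF assms(3,1)])
  have "homogeneous X (Suc j) c"
    unfolding c_def coboundary_def[abs_def]
    using hom_q assms(1) by (intro homogeneous_sum homogeneous_create)
  then have hom_u: "homogeneous X (Suc j) u"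
    unfolding u_def by (intro homogeneous_comb assms(3))
  have hom_bu: "homogeneous X j (boundary X u)"
    by (rule homogeneous_boundary[OF hom_u assms(1)])
  have bubu: "pow_inner X (boundary X u) (boundary X u) = (a + b * n)\<^sup>2 * R"
  proof -
    have "pow_inner X (boundary X u) (boundary X u) =
        pow_inner X (\<lambda>S. (a + b * n) * q S + 0 * q S) (\<lambda>S. (a + b * n) * q S + 0 * q S)"
      by (rule pow_inner_cong) (use bu in auto)
    then show ?thesis
      unfolding pow_inner_comb_left pow_inner_comb_right by (simp add: R_def power2_eq_square)
  qed
  \<comment> \<open>The kernel bound on \<open>X - {x}\<close> with
    \<open>r = annihilate x u\<close>. That vector vanishes at sets containing \<open>x\<close>, so
    inner products with it may be taken over all of \<open>X\<close>.\<close>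
  have each: "pow_inner (X - {x}) (g x) (g x) \<ge> 2 * pow_inner X (create x (g x)) u -
      pow_inner X (annihilate x u) (annihilate x u) +
      pow_inner X (annihilate x (boundary X u)) (annihilate x (boundary X u)) / (n - 1)"
    if x: "x \<in> X" for x
  proof -
    have card: "real (card (X - {x})) = n - 1"
      using x n assms(1) by (simp add: n_def of_nat_diff card_gt_0_iff)
    then have "X - {x} \<noteq> {}"
      using n by force
    then have "pow_inner (X - {x}) (g x) (g x) \<ge> 2 * pow_inner (X - {x}) (g x) (annihilate x u) -
        pow_inner (X - {x}) (annihilate x u) (annihilate x u) +
        pow_inner (X - {x}) (boundary (X - {x}) (annihilate x u)) (boundary (X - {x}) (annihilate x u)) / card (X - {x})"
      using ker[OF x] assms(1) by (intro pow_inner_kernel_bound) auto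
    moreover have "pow_inner (X - {x}) (boundary (X - {x}) (annihilate x u)) (boundary (X - {x}) (annihilate x u)) =
       pow_inner (X - {x}) (annihilate x (boundary X u)) (annihilate x (boundary X u))"
      unfolding pow_inner_def
    proof (rule sum.cong[OF refl])
      fix S assume "S \<in> Pow (X - {x})"
      then have "finite S"
        using assms(1) finite_subset[of S X] by auto
      then show "boundary (X - {x}) (annihilate x u) S * boundary (X - {x}) (annihilate x u) S =
          annihilate x (boundary X u) S * annihilate x (boundary X u) S"
        by (simp add: boundary_remove_annihilate[OF assms(1) x])
    qed
    moreover have "pow_inner X (g x) (annihilate x u) = pow_inner X (create x (g x)) u"
      by (simp add: pow_inner_commute[of X "g x"] pow_inner_commute[of X _ u] pow_inner_annihilate[OF assms(1) x])
    ultimately show ?thesis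
      by (simp add: card pow_inner_remove_annihilate[OF assms(1) x])
  qed
  have "(\<Sum>x\<in>X. pow_inner X (create x (g x)) u) = pow_inner X (\<lambda>S. \<Sum>x\<in>X. create x (g x) S) u"
    using pow_inner_sum_left[where X = X and F = X and c = "\<lambda>_. 1" and w = "\<lambda>x. create x (g x)" and v = u]
    by simp
  also have "\<dots> = pow_inner X p u"
    by (rule pow_inner_cong) (simp_all add: p)
  finally have cross: "(\<Sum>x\<in>X. pow_inner X (create x (g x)) u) = a * P + b * R"
    by (simp add: pu)
  have "(\<Sum>x\<in>X. pow_inner (X - {x}) (g x) (g x)) \<ge>
      (\<Sum>x\<in>X. 2 * pow_inner X (create x (g x)) u -
      pow_inner X (annihilate x u) (annihilate x u) +
      pow_inner X (annihilate x (boundary X u)) (annihilate x (boundary X u)) / (n - 1))"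
    by (intro sum_mono each)
  \<comment> \<open>The number operator evaluates the two quadratic terms, in degrees
    \<open>Suc j\<close> and \<open>j\<close>.\<close>
  also have "(\<Sum>x\<in>X. 2 * pow_inner X (create x (g x)) u -
      pow_inner X (annihilate x u) (annihilate x u) +
      pow_inner X (annihilate x (boundary X u)) (annihilate x (boundary X u)) / (n - 1)) =
      2 * (a * P + b * R) - Suc j * pow_inner X u u + j * pow_inner X (boundary X u) (boundary X u) / (n - 1)"
    by (simp add: sum.distrib sum_subtractf cross sum_pow_inner_annihilate[OF assms(1) hom_u]
        sum_pow_inner_annihilate[OF assms(1) hom_bu] flip: sum_distrib_left sum_divide_distrib)
  \<comment> \<open>The choice of \<open>a\<close> and \<open>b\<close> makes the quadratic terms
    together equal to \<open>pow_inner X p u\<close>, so half of the linear term remains.\<close>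
  also have "\<dots> = a * P + b * R"
  proof -
    have a: "real (Suc j) * a = 1"
      by (simp add: a_def)
    have ab: "a + b * n = (n - 1) / d"
    proof -
      have "a + b * n = a * ((d + j * n) / d)"
        using n(2) by (simp add: b_def field_simps)
      also have "d + j * n = real (Suc j) * (n - 1)"
        by (simp add: d_def algebra_simps)
      also have "a * (real (Suc j) * (n - 1) / d) = (real (Suc j) * a) * ((n - 1) / d)"
        by simp
      finally show ?thesis by (simp only: a mult_1_left)
    qed
    have "real (Suc j) * b = (real (Suc j) * a) * (j / d)"
      by (simp add: b_def)
    then have jb: "real (Suc j) * b = j / d"
      by (simp only: a mult_1_left)
    have "Suc j * (a * a * P + 2 * a * b * R + b * b * n * R) =
       (Suc j * a) * a * P + (Suc j * a) * b * R + (Suc j * b) * (a + b * n) * R"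
      by (simp add: algebra_simps)
    also have "\<dots> = a * P + b * R + j * (n - 1) / (d * d) * R"
      by (simp only: a jb ab) simp
    finally have *: "Suc j * pow_inner X u u = a * P + b * R + j * (n - 1) / (d * d) * R"
      by (simp only: uu)
    have "j * pow_inner X (boundary X u) (boundary X u) / (n - 1) = j * (n - 1) / (d * d) * R"
      using n by (simp add: bubu ab power2_eq_square)
    with * show ?thesis
      by simp
  qed
  finally show ?thesis
    by (simp add: a_def b_def d_def n_def P_def R_def q_def)
qed

section \<open>Summation of the kernel bound over basis vectors\<close>

text \<open>Double counting: a set of size \<open>Suc j\<close> arises by insertion in
  \<open>Suc j\<close> ways.\<close>

lemma sum_layer_insert:
  fixes f :: "'a set \<Rightarrow> real"
  assumes "finite Y"
  shows "(\<Sum>T\<in>layer Y j. \<Sum>y\<in>Y - T. f (insert y T)) = Suc j * (\<Sum>T\<in>layer Y (Suc j). f T)"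
proof -
  have fin: "finite T" if "T \<in> layer Y k" for T k
    using that assms by (auto simp: layer_def intro: finite_subset)
  have "(\<Sum>T\<in>layer Y j. \<Sum>y\<in>Y - T. f (insert y T)) =
      (\<Sum>(T, y)\<in>(SIGMA T:layer Y j. Y - T). f (insert y T))"
    by (rule sum.Sigma) (use assms in auto)
  also have "\<dots> = (\<Sum>(T, y)\<in>(SIGMA T:layer Y (Suc j). T). f T)"
  proof (rule sum.reindex_bij_witness[where i = "\<lambda>(T, y). (T - {y}, y)" and j = "\<lambda>(T, y). (insert y T, y)"], goal_cases)
    case (2 a)
    then show ?case using fin by (fastforce simp: layer_def)
  next
    case (4 b)
    then show ?case using fin by (fastforce simp: layer_def)
  qed auto
  also have "\<dots> = (\<Sum>T\<in>layer Y (Suc j). \<Sum>y\<in>T. f T)"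
    by (rule sum.Sigma[symmetric]) (use fin assms in auto)
  also have "\<dots> = (\<Sum>T\<in>layer Y (Suc j). Suc j * f T)"
    by (rule sum.cong) (auto simp: layer_def)
  finally show ?thesis
    by (simp add: sum_distrib_left)
qed

lemma pull_comb: "pull A (\<lambda>S. a * v S + b * w S) S = a * pull A v S + b * pull A w S"
  by (simp add: pull_def algebra_simps sum.distrib sum_distrib_left)

lemma layer_remove: "layer (Y - {y}) j = {T \<in> layer Y j. y \<notin> T}"
  by (auto simp: layer_def)

lemma create_unit_vec:
  "create y (unit_vec T) = (\<lambda>S. if y \<in> T then 0 else pos_sign y T * unit_vec (insert y T) S)"
  by (rule ext) (auto simp: create_def unit_vec_def)

lemma boundary_scale: "boundary X (\<lambda>S. c * v S) S = c * boundary X v S"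
  using boundary_sum[where F = "{()}" and c = "\<lambda>_. c" and w = "\<lambda>_. v"] by simp

lemma boundary_zero [simp]: "boundary X (\<lambda>S. 0) S = 0"
  by (auto simp: boundary_def annihilate_def intro: sum.neutral)

lemma boundary_remove_unit_vec:
  assumes "finite Y" "y \<notin> T"
  shows "boundary (Y - {y}) (unit_vec T) = boundary Y (unit_vec T)"
proof
  fix S
  have "annihilate y (unit_vec T) S = 0"
    using assms(2) by (auto simp: annihilate_def unit_vec_def)
  then show "boundary (Y - {y}) (unit_vec T) S = boundary Y (unit_vec T) S"
    using assms(1) by (cases "y \<in> Y") (simp_all add: boundary_def sum.remove)
qed

text \<open>Anticommutation writes \<open>create y (boundary Y (unit_vec T))\<close> as
  \<open>unit_vec T\<close> minus the boundary of \<open>unit_vec (insert y T)\<close> up to sign;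
  the sign disappears in the last, quadratic term. The cross term is left as it stands because its
  sum over \<open>y\<close> forms a coboundary.\<close>

lemma pull_form_create_boundary:
  assumes "bij_family X Y A" "y \<in> Y" "y \<notin> T"
  shows "pull_form A A X (create y (boundary Y (unit_vec T))) (create y (boundary Y (unit_vec T))) =
    pull_form A A X (unit_vec T) (unit_vec T) -
    2 * pull_form A A X (unit_vec T) (boundary Y (create y (unit_vec T))) +
    pull_form A A X (boundary Y (unit_vec (insert y T))) (boundary Y (unit_vec (insert y T)))"
proof -
  have fin: "finite Y"
    using assms(1) by (simp add: bij_family_def)
  define z where "z = boundary Y (create y (unit_vec T))"
  \<comment> \<open>The summand \<open>0 * 0\<close> only gives \<open>z\<close> the shape of a
    combination of two vectors, to which \<open>pull_comb\<close> applies.\<close>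
  have z: "z = (\<lambda>S. pos_sign y T * boundary Y (unit_vec (insert y T)) S + 0 * 0)"
    using assms(3) by (simp add: z_def create_unit_vec boundary_scale[abs_def])
  have "create y (boundary Y (unit_vec T)) S = 1 * unit_vec T S + (-1) * z S" if "S \<subseteq> Y" for S
    using boundary_create[of S Y y "unit_vec T"] finite_subset[OF that fin] fin assms(2)
    by (simp add: z_def)
  then have "pull_form A A X (create y (boundary Y (unit_vec T))) (create y (boundary Y (unit_vec T))) =
      pull_form A A X (\<lambda>S. 1 * unit_vec T S + (-1) * z S) (\<lambda>S. 1 * unit_vec T S + (-1) * z S)"
    by (intro pull_form_cong[OF assms(1,1)])
  also have "\<dots> = pull_form A A X (unit_vec T) (unit_vec T) - 2 * pull_form A A X (unit_vec T) z +
      pull_form A A X z z"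
    unfolding pull_form_def pull_comb[abs_def] pow_inner_comb_left pow_inner_comb_right
    by (simp add: pow_inner_commute[of X "pull A z" "pull A (unit_vec T)"])
  also have "pull_form A A X z z =
      pull_form A A X (boundary Y (unit_vec (insert y T))) (boundary Y (unit_vec (insert y T)))"
    unfolding z pull_form_def pull_comb[abs_def] pow_inner_comb_left pow_inner_comb_right
    by (simp add: pow_inner_def)
  finally show ?thesis
    by (simp add: z_def)
qed

text \<open>In units of the sum over \<open>layer Y (Suc (Suc i))\<close>, the cross terms
  contribute -2, as they form a coboundary and the trace is cyclic, and the insertion count
  contributes \<open>i + 2\<close>; this leaves \<open>i\<close>.\<close>

lemma sum_pull_form_create_boundary:
  assumes "bij_family X Y A"
  shows "(\<Sum>T\<in>layer Y (Suc i). \<Sum>y\<in>Y - T.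
      pull_form A A X (create y (boundary Y (unit_vec T))) (create y (boundary Y (unit_vec T)))) =
    (real (card Y) - Suc i) * ext_form X Y (Suc i) A A + real i * real (card Y) * std_form X Y (Suc i) A A"
proof -
  define D where "D = (\<lambda>T. pull_form A A X (boundary Y (unit_vec T)) (boundary Y (unit_vec T)))"
  have fin: "finite Y"
    using assms by (simp add: bij_family_def)
  have std: "(\<Sum>T\<in>layer Y (Suc (Suc i)). D T) = card Y * std_form X Y (Suc i) A A"
  proof (cases "Y = {}")
    case True
    then have "layer Y (Suc (Suc i)) = {}"
      by (auto simp: layer_def)
    then show ?thesis
      by (simp add: std_form_def)
  qed (use fin in \<open>simp add: std_form_def D_def\<close>)
  have "(\<Sum>y\<in>Y - T. pull_form A A X (create y (boundary Y (unit_vec T))) (create y (boundary Y (unit_vec T)))) =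
      (real (card Y) - Suc i) * pull_form A A X (unit_vec T) (unit_vec T) -
      2 * pull_form A A X (unit_vec T) (boundary Y (coboundary Y (unit_vec T))) +
      (\<Sum>y\<in>Y - T. D (insert y T))" if T: "T \<in> layer Y (Suc i)" for T
  proof -
    have TY: "T \<subseteq> Y" "card T = Suc i" "finite T"
      using T fin by (auto simp: layer_def intro: finite_subset)
    have "(\<Sum>y\<in>Y - T. pull_form A A X (create y (boundary Y (unit_vec T))) (create y (boundary Y (unit_vec T)))) =
        (\<Sum>y\<in>Y - T. pull_form A A X (unit_vec T) (unit_vec T) -
          2 * pull_form A A X (unit_vec T) (boundary Y (create y (unit_vec T))) + D (insert y T))"
      by (rule sum.cong) (simp_all add: pull_form_create_boundary[OF assms] D_def)
    also have "\<dots> = card (Y - T) * pull_form A A X (unit_vec T) (unit_vec T) -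
        2 * (\<Sum>y\<in>Y - T. pull_form A A X (unit_vec T) (boundary Y (create y (unit_vec T)))) +
        (\<Sum>y\<in>Y - T. D (insert y T))"
      by (simp add: sum.distrib sum_subtractf sum_distrib_left)
    also have "real (card (Y - T)) = real (card Y) - Suc i"
      using TY fin card_mono[OF fin TY(1)] by (simp add: card_Diff_subset of_nat_diff)
    \<comment> \<open>For \<open>y\<close> in \<open>T\<close> creation kills
      \<open>unit_vec T\<close>, so the sum extends to the full coboundary.\<close>
    also have "(\<Sum>y\<in>Y - T. pull_form A A X (unit_vec T) (boundary Y (create y (unit_vec T)))) =
        (\<Sum>y\<in>Y. pull_form A A X (unit_vec T) (boundary Y (create y (unit_vec T))))"
    proof (rule sum.mono_neutral_left)
      show "\<forall>y\<in>Y - (Y - T). pull_form A A X (unit_vec T) (boundary Y (create y (unit_vec T))) = 0"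
        by (auto simp: create_unit_vec pull_form_def pull_def[abs_def] pow_inner_def)
    qed (use fin in auto)
    also have "\<dots> = pull_form A A X (unit_vec T) (boundary Y (coboundary Y (unit_vec T)))"
    proof -
      have "boundary Y (coboundary Y (unit_vec T)) =
          (\<lambda>S. \<Sum>y\<in>Y. 1 * boundary Y (create y (unit_vec T)) S)"
        unfolding coboundary_def[abs_def]
        using boundary_sum[where F = Y and c = "\<lambda>_. 1" and w = "\<lambda>y. create y (unit_vec T)"]
        by (simp add: fun_eq_iff)
      then show ?thesis
        using pull_form_sum_right[where A = A and B = A and X = X and v = "unit_vec T"
            and F = Y and c = "\<lambda>_. 1" and w = "\<lambda>y. boundary Y (create y (unit_vec T))"]
        by simp
    qed
    finally show ?thesis .
  qed
  then have "(\<Sum>T\<in>layer Y (Suc i). \<Sum>y\<in>Y - T.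
      pull_form A A X (create y (boundary Y (unit_vec T))) (create y (boundary Y (unit_vec T)))) =
      (real (card Y) - Suc i) * ext_form X Y (Suc i) A A -
      2 * (\<Sum>T\<in>layer Y (Suc (Suc i)). D T) +
      (\<Sum>T\<in>layer Y (Suc i). \<Sum>y\<in>Y - T. D (insert y T))"
    unfolding D_def sum_layer_boundary_coboundary[OF assms assms, symmetric]
    by (simp add: sum.distrib sum_subtractf ext_form_def flip: sum_distrib_left)
  also have "(\<Sum>T\<in>layer Y (Suc i). \<Sum>y\<in>Y - T. D (insert y T)) =
      Suc (Suc i) * (\<Sum>T\<in>layer Y (Suc (Suc i)). D T)"
    by (rule sum_layer_insert[OF fin])
  finally show ?thesis
    by (simp add: std algebra_simps)
qed

text \<open>For fixed \<open>y\<close> and \<open>T\<close> avoiding \<open>y\<close>, the pulls of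
  \<open>boundary Y (unit_vec T)\<close> by the fibres \<open>p x = y\<close> lie in the kernel of
  the boundary of \<open>X - {x}\<close>, and their creations sum to the pull by \<open>A\<close> of
  \<open>create y (boundary Y (unit_vec T))\<close>. So \<open>sum_kernel_bound\<close> applies, and
  its lower bound is then summed over all \<open>y\<close> and \<open>T\<close>.\<close>

lemma std_form_step:
  assumes "bij_family X Y A" "Suc i < card X"
  shows "std_form X Y i A A + std_form X Y (Suc i) A A \<le>
    (\<Sum>x\<in>X. \<Sum>y\<in>Y. std_form (X - {x}) (Y - {y}) i {p\<in>A. p x = y} {p\<in>A. p x = y})"
proof -
  define N where "N = real (card Y)"
  define e where "e = N - Suc i"
  define F where "F = (\<Sum>x\<in>X. \<Sum>y\<in>Y. std_form (X - {x}) (Y - {y}) i {p\<in>A. p x = y} {p\<in>A. p x = y})"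
  define g where "g = (\<lambda>y T x. pull {p\<in>A. p x = y} (boundary Y (unit_vec T)))"
  define P where "P = (\<lambda>y T. pull_form A A X (create y (boundary Y (unit_vec T))) (create y (boundary Y (unit_vec T))))"
  define R where "R = (\<lambda>T. pull_form A A X (boundary Y (unit_vec T)) (boundary Y (unit_vec T)))"
  have fin: "finite X" "finite Y" "finite A" and card: "card X = card Y"
    and bij: "\<And>p. p \<in> A \<Longrightarrow> bij_betw p X Y"
    using assms(1) by (auto simp: bij_family_def)
  have N: "N > 1" "e > 0"
    using assms(2) card by (auto simp: N_def e_def)
  have TY: "T \<subseteq> Y" "card T = j" "finite T" if "T \<in> layer Y j" for T j
    using that fin by (auto simp: layer_def intro: finite_subset)
  have each: "(\<Sum>x\<in>X. pow_inner (X - {x}) (g y T x) (g y T x)) \<ge> P y T / (real i + 1) + i * R T / ((real i + 1) * e)"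
    if y: "y \<in> Y" and T: "T \<in> layer Y (Suc i)" "y \<notin> T" for y T
  proof -
    define w where "w = boundary Y (unit_vec T)"
    define p where "p = pull A (create y w)"
    have "homogeneous Y (Suc i) (unit_vec T)"
      using TY[OF T(1)] by (auto simp: homogeneous_def unit_vec_def)
    then have "homogeneous Y (Suc i) (create y w)"
      unfolding w_def using y fin by (intro homogeneous_create homogeneous_boundary)
    then have hom: "homogeneous X (Suc i) p"
      unfolding p_def by (rule homogeneous_pull[OF _ assms(1)])
    have ker: "boundary (X - {x}) (g y T x) S = 0" if "x \<in> X" "S \<subseteq> X - {x}" for x S
    proof -
      have fam: "bij_family (X - {x}) (Y - {y}) {p\<in>A. p x = y}"
        by (rule bij_family_remove[OF assms(1) that(1) y])
      have fS: "finite S"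
        using that fin finite_subset[of S X] by auto
      have "boundary (X - {x}) (g y T x) S = pull {p\<in>A. p x = y} (boundary (Y - {y}) (boundary Y (unit_vec T))) S"
        unfolding g_def
        by (rule pull_boundary[symmetric]) (use fam that fin in \<open>auto simp: bij_family_def\<close>)
      also have "\<dots> = 0"
        using fS by (simp add: pull_def flip: boundary_remove_unit_vec[OF fin(2) T(2)])
      finally show ?thesis .
    qed
    have sum: "p S = (\<Sum>x\<in>X. create x (g y T x) S)" if "S \<subseteq> X" for S
      unfolding p_def g_def w_def[symmetric] by (rule pull_create[OF bij that fin(1,3) y])
    have "(\<Sum>x\<in>X. pow_inner (X - {x}) (g y T x) (g y T x)) \<ge> pow_inner X p p / (real i + 1) +
        i * pow_inner X (boundary X p) (boundary X p) / ((real i + 1) * (real (card X) - 1 - i))"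
      by (rule sum_kernel_bound[OF fin(1) assms(2) hom ker sum])
    moreover have "pow_inner X p p = P y T"
      by (simp add: p_def P_def w_def pull_form_def)
    \<comment> \<open>\<open>w\<close> is itself a boundary, so anticommutation reduces
      \<open>boundary Y (create y w)\<close> to \<open>w\<close>.\<close>
    moreover have "pow_inner X (boundary X p) (boundary X p) = R T"
    proof -
      have "boundary Y (create y w) S = w S" if "S \<subseteq> Y" for S
      proof -
        have "create y (boundary Y w) S = 0"
          using finite_subset[OF that fin(2)] by (simp add: create_def w_def)
        then show ?thesis
          using boundary_create[of S Y y w] finite_subset[OF that fin(2)] fin(2) y by simp
      qed
      then have "boundary X p S = pull A w S" if "S \<subseteq> X" for S
        using pull_boundary[OF bij that fin(1), where v = "create y w"] pull_cong[OF assms(1) _ that, of "boundary Y (create y w)" w]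
        by (simp add: p_def)
      then show ?thesis
        unfolding R_def pull_form_def w_def[symmetric] by (intro pow_inner_cong)
    qed
    moreover have "real (card X) - 1 - i = e"
      by (simp add: e_def N_def card)
    ultimately show ?thesis
      by simp
  qed
  \<comment> \<open>For \<open>T\<close> avoiding \<open>y\<close> the boundaries of
    \<open>unit_vec T\<close> in \<open>Y\<close> and in \<open>Y - {y}\<close> agree; the factor
    \<open>N - 1\<close> clears the normalisation of \<open>std_form\<close>.\<close>
  have "(N - 1) * std_form (X - {x}) (Y - {y}) i {p\<in>A. p x = y} {p\<in>A. p x = y} =
      (\<Sum>T | T \<in> layer Y (Suc i) \<and> y \<notin> T. pow_inner (X - {x}) (g y T x) (g y T x))"
    if "x \<in> X" "y \<in> Y" for x y
  proof -
    have "real (card (Y - {y})) = N - 1"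
      using that fin N by (simp add: N_def of_nat_diff card_gt_0_iff)
    then show ?thesis
      using N fin by (simp add: std_form_def layer_remove pull_form_def g_def boundary_remove_unit_vec)
  qed
  then have "(N - 1) * F = (\<Sum>x\<in>X. \<Sum>y\<in>Y. \<Sum>T | T \<in> layer Y (Suc i) \<and> y \<notin> T. pow_inner (X - {x}) (g y T x) (g y T x))"
    by (simp add: F_def sum_distrib_left)
  also have "\<dots> = (\<Sum>y\<in>Y. \<Sum>x\<in>X. \<Sum>T | T \<in> layer Y (Suc i) \<and> y \<notin> T. pow_inner (X - {x}) (g y T x) (g y T x))"
    by (rule sum.swap)
  also have "\<dots> = (\<Sum>y\<in>Y. \<Sum>T | T \<in> layer Y (Suc i) \<and> y \<notin> T. \<Sum>x\<in>X. pow_inner (X - {x}) (g y T x) (g y T x))"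
    by (intro sum.cong refl sum.swap)
  also have "\<dots> \<ge> (\<Sum>y\<in>Y. \<Sum>T | T \<in> layer Y (Suc i) \<and> y \<notin> T. P y T / (real i + 1) + i * R T / ((real i + 1) * e))"
    by (intro sum_mono) (use each in auto)
  also have "(\<Sum>y\<in>Y. \<Sum>T | T \<in> layer Y (Suc i) \<and> y \<notin> T. P y T / (real i + 1) + i * R T / ((real i + 1) * e)) =
      (\<Sum>T\<in>layer Y (Suc i). \<Sum>y | y \<in> Y \<and> y \<notin> T. P y T / (real i + 1) + i * R T / ((real i + 1) * e))"
    using fin by (intro sum.swap_restrict) auto
  also have "\<dots> = (\<Sum>T\<in>layer Y (Suc i). (\<Sum>y\<in>Y - T. P y T) / (real i + 1) + e * (i * R T / ((real i + 1) * e)))"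
  proof (rule sum.cong[OF refl])
    fix T assume T: "T \<in> layer Y (Suc i)"
    have "real (card (Y - T)) = e"
      using TY[OF T] fin card_mono[of Y T] by (simp add: e_def N_def card_Diff_subset of_nat_diff)
    then show "(\<Sum>y | y \<in> Y \<and> y \<notin> T. P y T / (real i + 1) + i * R T / ((real i + 1) * e)) =
        (\<Sum>y\<in>Y - T. P y T) / (real i + 1) + e * (i * R T / ((real i + 1) * e))"
      by (simp add: set_diff_eq sum.distrib flip: sum_divide_distrib)
  qed
  also have "\<dots> = (\<Sum>T\<in>layer Y (Suc i). \<Sum>y\<in>Y - T. P y T) / (real i + 1) + i / (real i + 1) * (\<Sum>T\<in>layer Y (Suc i). R T)"
    using N by (simp add: sum.distrib sum_distrib_left flip: sum_divide_distrib)
  also have "(\<Sum>T\<in>layer Y (Suc i). R T) = N * std_form X Y i A A"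
    using N by (simp add: R_def std_form_def N_def)
  also have "(\<Sum>T\<in>layer Y (Suc i). \<Sum>y\<in>Y - T. P y T) =
      e * ext_form X Y (Suc i) A A + i * N * std_form X Y (Suc i) A A"
    unfolding P_def e_def N_def by (rule sum_pull_form_create_boundary[OF assms(1)])
  also have "ext_form X Y (Suc i) A A = std_form X Y (Suc i) A A + std_form X Y i A A"
    using ext_form_Suc[OF assms(1,1)] N fin by (force simp: N_def)
  finally have "(N - 1) * F \<ge> (e * (std_form X Y (Suc i) A A + std_form X Y i A A) +
      i * N * std_form X Y (Suc i) A A) / (real i + 1) + i / (real i + 1) * (N * std_form X Y i A A)" .
  \<comment> \<open>The boundary term of the kernel bound supplies exactly the multiple that the
    form of degree \<open>i\<close> lacks, so both forms get the same coefficient, and this turns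
    out to be \<open>N - 1\<close>.\<close>
  also have "(e * (std_form X Y (Suc i) A A + std_form X Y i A A) +
      i * N * std_form X Y (Suc i) A A) / (real i + 1) + i / (real i + 1) * (N * std_form X Y i A A) =
      (e + i * N) / (real i + 1) * (std_form X Y (Suc i) A A + std_form X Y i A A)"
    by (simp add: add_divide_distrib ring_distribs)
  also have "e + i * N = (real i + 1) * (N - 1)"
    by (simp add: e_def algebra_simps)
  also have "(real i + 1) * (N - 1) / (real i + 1) = N - 1"
    by simp
  finally have "std_form X Y (Suc i) A A + std_form X Y i A A \<le> F"
    using N(1) by simp
  then show ?thesis
    by (simp add: F_def add.commute)
qed

section \<open>Lefschetz numbers and duality\<close>

text \<open>This is the trace of q^-1 p on the exterior power: a basis wedge contributes to the
  diagonal only if its set has the same image under \<open>p\<close> and \<open>q\<close>, and then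
  with the product of the two signs.\<close>

lemma ext_form_pair:
  assumes "finite X" "bij_betw p X Y" "bij_betw q X Y"
  shows "ext_form X Y j {p} {q} = (\<Sum>S | S \<in> layer X j \<and> p ` S = q ` S. map_sign p S * map_sign q S)"
proof -
  have fin: "finite Y"
    using assms bij_betw_finite by blast
  have "ext_form X Y j {p} {q} =
      (\<Sum>T\<in>layer Y j. \<Sum>S\<in>Pow X. map_sign p S * map_sign q S * of_bool (p ` S = T \<and> q ` S = T))"
    unfolding ext_form_def pull_form_def pow_inner_def pull_def
    by (intro sum.cong refl) (auto simp: unit_vec_def)
  also have "\<dots> = (\<Sum>S\<in>Pow X. \<Sum>T\<in>layer Y j. map_sign p S * map_sign q S * of_bool (p ` S = T \<and> q ` S = T))"
    by (rule sum.swap)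
  also have "\<dots> = (\<Sum>S\<in>Pow X. if S \<in> layer X j \<and> p ` S = q ` S then map_sign p S * map_sign q S else 0)"
  proof (rule sum.cong[OF refl])
    fix S assume S: "S \<in> Pow X"
    then have "p ` S \<subseteq> Y" "inj_on p S"
      using assms(2) inj_on_subset[of p X S] by (auto simp: bij_betw_def)
    then have "p ` S \<in> layer Y j \<longleftrightarrow> S \<in> layer X j"
      using S card_image[of p S] by (auto simp: layer_def)
    moreover have "(\<Sum>T\<in>layer Y j. map_sign p S * map_sign q S * of_bool (p ` S = T \<and> q ` S = T)) =
        (\<Sum>T\<in>layer Y j. if T = p ` S then map_sign p S * map_sign q S * of_bool (q ` S = p ` S) else 0)"
      by (intro sum.cong) auto
    ultimately show "(\<Sum>T\<in>layer Y j. map_sign p S * map_sign q S * of_bool (p ` S = T \<and> q ` S = T)) =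
        (if S \<in> layer X j \<and> p ` S = q ` S then map_sign p S * map_sign q S else 0)"
      using fin by (auto simp: of_bool_def)
  qed
  also have "\<dots> = (\<Sum>S | S \<in> Pow X \<and> (S \<in> layer X j \<and> p ` S = q ` S). map_sign p S * map_sign q S)"
    by (rule sum.inter_filter[symmetric]) (simp add: assms(1))
  also have "{S \<in> Pow X. S \<in> layer X j \<and> p ` S = q ` S} = {S. S \<in> layer X j \<and> p ` S = q ` S}"
    by (auto simp: layer_def)
  finally show ?thesis .
qed

lemma ext_form_sum_pairs:
  "ext_form X Y j A B = (\<Sum>p\<in>A. \<Sum>q\<in>B. ext_form X Y j {p} {q})"
proof -
  have "pull_form A B X v w = (\<Sum>p\<in>A. \<Sum>q\<in>B. pull_form {p} {q} X v w)" for v w :: "'b set \<Rightarrow> real"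
  proof -
    have "pull_form A B X v w = (\<Sum>S\<in>Pow X. \<Sum>p\<in>A. \<Sum>q\<in>B. pull {p} v S * pull {q} w S)"
      by (simp add: pull_form_def pow_inner_def pull_def sum_product)
    also have "\<dots> = (\<Sum>p\<in>A. \<Sum>S\<in>Pow X. \<Sum>q\<in>B. pull {p} v S * pull {q} w S)"
      by (rule sum.swap)
    also have "\<dots> = (\<Sum>p\<in>A. \<Sum>q\<in>B. pull_form {p} {q} X v w)"
      unfolding pull_form_def pow_inner_def by (intro sum.cong refl sum.swap)
    finally show ?thesis .
  qed
  then have "ext_form X Y j A B = (\<Sum>T\<in>layer Y j. \<Sum>p\<in>A. \<Sum>q\<in>B. pull_form {p} {q} X (unit_vec T) (unit_vec T))"
    by (simp add: ext_form_def)
  also have "\<dots> = (\<Sum>p\<in>A. \<Sum>T\<in>layer Y j. \<Sum>q\<in>B. pull_form {p} {q} X (unit_vec T) (unit_vec T))"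
    by (rule sum.swap)
  also have "\<dots> = (\<Sum>p\<in>A. \<Sum>q\<in>B. ext_form X Y j {p} {q})"
    unfolding ext_form_def by (intro sum.cong refl sum.swap)
  finally show ?thesis .
qed

lemma std_form_card: "finite Y \<Longrightarrow> std_form X Y (card Y) A B = 0"
proof -
  assume "finite Y"
  then have "layer Y (Suc (card Y)) = {}"
    by (auto simp: layer_def dest: card_mono)
  then show ?thesis
    by (simp add: std_form_def)
qed

text \<open>The splitting in \<open>ext_form_Suc\<close> makes the sum telescope.\<close>

lemma ext_form_alternating_sum:
  assumes "bij_family X Y A" "bij_family X Y B" "Y \<noteq> {}"
  shows "(\<Sum>i\<le>j. (-1) ^ i * ext_form X Y i A B) = (-1) ^ j * std_form X Y j A B"
  by (induction j) (simp_all add: ext_form_0[OF assms] ext_form_Suc[OF assms] algebra_simps)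

text \<open>Each term on the left is a partial alternating sum of exterior forms, and degree
  \<open>i\<close> occurs in \<open>n - i\<close> of these. For \<open>n = card X\<close> and single
  maps the right side is the derivative at 1 of the characteristic polynomial of q^-1 p.\<close>

lemma std_form_alternating_sum:
  assumes "bij_family X Y A" "bij_family X Y B" "Y \<noteq> {}"
  shows "(\<Sum>j<n. (-1) ^ j * std_form X Y j A B) =
    (\<Sum>i\<le>n. (-1) ^ i * (real n - real i) * ext_form X Y i A B)"
proof (induction n)
  case (Suc n)
  have "(\<Sum>j<Suc n. (-1) ^ j * std_form X Y j A B) =
      (\<Sum>i\<le>n. (-1) ^ i * (real n - real i) * ext_form X Y i A B) + (\<Sum>i\<le>n. (-1) ^ i * ext_form X Y i A B)"
    by (simp add: Suc ext_form_alternating_sum[OF assms])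
  also have "\<dots> = (\<Sum>i\<le>n. (-1) ^ i * (real (Suc n) - real i) * ext_form X Y i A B)"
    by (simp add: algebra_simps flip: sum.distrib)
  finally show ?case
    by simp
qed simp

lemma sum_layers:
  assumes "finite X"
  shows "(\<Sum>j\<le>card X. \<Sum>S | S \<in> layer X j \<and> P S. f j S) = (\<Sum>S | S \<subseteq> X \<and> P S. f (card S) S)"
proof -
  have "(\<Sum>j\<le>card X. \<Sum>S | S \<in> layer X j \<and> P S. f j S) =
      (\<Sum>j\<le>card X. \<Sum>S | S \<in> {S. S \<subseteq> X \<and> P S} \<and> card S = j. f j S)"
    by (intro sum.cong) (auto simp: layer_def)
  also have "\<dots> = (\<Sum>j\<le>card X. \<Sum>S | S \<in> {S. S \<subseteq> X \<and> P S} \<and> card S = j. f (card S) S)"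
    by (intro sum.cong) auto
  also have "\<dots> = (\<Sum>S | S \<subseteq> X \<and> P S. f (card S) S)"
    by (rule sum.group) (use assms in \<open>auto intro: card_mono\<close>)
  finally show ?thesis .
qed

lemma bij_family_singleton:
  "finite X \<Longrightarrow> bij_betw p X Y \<Longrightarrow> bij_family X Y {p}"
  by (simp add: bij_family_def bij_betw_finite bij_betw_same_card)

text \<open>
  The Lefschetz number of \<open>q\<inverse> p\<close> acting on the exterior algebra, i.e. \<open>det (1 - q\<inverse> p)\<close>; it
  vanishes as the constant vectors are fixed.
\<close>

lemma lefschetz_sum_eq_0:
  assumes "finite X" "X \<noteq> {}" "bij_betw p X Y" "bij_betw q X Y"
  shows "(\<Sum>S | S \<subseteq> X \<and> p ` S = q ` S. (-1) ^ card S * (map_sign p S * map_sign q S)) = 0"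
proof -
  have Y: "Y \<noteq> {}" "finite Y" "card Y = card X"
    using assms bij_betw_finite bij_betw_same_card by (fastforce simp: bij_betw_def)+
  have "(\<Sum>S | S \<subseteq> X \<and> p ` S = q ` S. (-1) ^ card S * (map_sign p S * map_sign q S)) =
      (\<Sum>j\<le>card X. (-1) ^ j * ext_form X Y j {p} {q})"
    by (simp add: ext_form_pair[OF assms(1,3,4)] sum_distrib_left
        flip: sum_layers[OF assms(1), where P = "\<lambda>S. p ` S = q ` S"
          and f = "\<lambda>j S. (-1) ^ j * (map_sign p S * map_sign q S)"])
  also have "\<dots> = (-1) ^ card X * std_form X Y (card X) {p} {q}"
    using assms Y by (intro ext_form_alternating_sum bij_family_singleton)
  also have "\<dots> = 0"
    using std_form_card[OF Y(2), of X "{p}" "{q}"] Y(3) by simp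
  finally show ?thesis .
qed

text \<open>The mixed factor \<open>K\<close> from \<open>map_sign_Un\<close> depends only on
  images, so it is the same for \<open>p\<close> and \<open>q\<close> and squares to 1.\<close>

lemma map_sign_mult_Un:
  assumes "finite S" "finite C" "S \<inter> C = {}" "inj_on p (S \<union> C)" "inj_on q (S \<union> C)"
    "p ` S = q ` S" "p ` C = q ` C"
  shows "map_sign p (S \<union> C) * map_sign q (S \<union> C) =
    (map_sign p S * map_sign q S) * (map_sign p C * map_sign q C)"
proof -
  define K where "K = (\<Prod>x\<in>C. pos_sign x S) * (\<Prod>y\<in>p ` C. pos_sign y (p ` S))"
  have "map_sign p (S \<union> C) = map_sign p S * map_sign p C * K"
    "map_sign q (S \<union> C) = map_sign q S * map_sign q C * K"
    using map_sign_Un[OF assms(1-4)] map_sign_Un[OF assms(1-3,5)] assms(6,7) by (simp_all add: K_def)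
  moreover have "K * K = 1"
  proof -
    have "K * K = ((\<Prod>x\<in>C. pos_sign x S) * (\<Prod>x\<in>C. pos_sign x S)) *
        ((\<Prod>y\<in>p ` C. pos_sign y (p ` S)) * (\<Prod>y\<in>p ` C. pos_sign y (p ` S)))"
      by (simp add: K_def mult_ac)
    then show ?thesis
      by (simp flip: prod.distrib)
  qed
  ultimately have "map_sign p (S \<union> C) * map_sign q (S \<union> C) =
      (map_sign p S * map_sign q S) * (map_sign p C * map_sign q C) * (K * K)"
    by (simp add: mult_ac)
  with \<open>K * K = 1\<close> show ?thesis
    by simp
qed

lemma image_complement_eq:
  assumes "bij_betw p X Y" "bij_betw q X Y" "C \<subseteq> X" "p ` C = q ` C"
  shows "p ` (X - C) = q ` (X - C)"
proof -
  have "f ` (X - C) = Y - f ` C" if "bij_betw f X Y" for f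
    using that assms(3) inj_on_image_set_diff[of f X X C] by (auto simp: bij_betw_def)
  then show ?thesis
    using assms by simp
qed

text \<open>The sets invariant under q^-1 p are the unions of an invariant subset of
  \<open>C\<close> and one of its complement. Signs multiply and weights add, so the sum splits into
  two products, each with an unweighted Lefschetz sum as a factor. In other words, 1 is a multiple
  root of the characteristic polynomial.\<close>

lemma weighted_lefschetz_sum_eq_0:
  fixes X :: "'a::linorder set"
  assumes "finite X" "bij_betw p X Y" "bij_betw q X Y"
    and C: "C \<noteq> {}" "C \<subset> X" "p ` C = q ` C"
  shows "(\<Sum>S | S \<subseteq> X \<and> p ` S = q ` S. (-1) ^ card S * (real (card X) - real (card S)) *
    (map_sign p S * map_sign q S)) = 0"
proof -
  define D where "D = X - C"
  define Inv where "Inv = (\<lambda>Z. {S. S \<subseteq> Z \<and> p ` S = q ` S})"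
  define u where "u = (\<lambda>S. (-1) ^ card S * (map_sign p S * map_sign q S))"
  define w where "w = (\<lambda>(Z :: 'a set) (S :: 'a set). real (card Z) - real (card S))"
  have D: "D \<noteq> {}" "p ` D = q ` D" "C \<union> D = X" "C \<inter> D = {}" "finite C" "finite D"
    using C assms(1) image_complement_eq[OF assms(2,3) _ C(3)] finite_subset[of C X]
    by (auto simp: D_def)
  have inj: "inj_on p X" "inj_on q X"
    using assms by (auto simp: bij_betw_def)
  have lef: "sum u (Inv Z) = 0" if "Z \<noteq> {}" "Z \<subseteq> X" "p ` Z = q ` Z" for Z
    unfolding u_def Inv_def
    by (rule lefschetz_sum_eq_0[of _ _ "p ` Z"])
       (use that inj_on_subset[OF inj(1) that(2)] inj_on_subset[OF inj(2) that(2)]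
         finite_subset[OF that(2) assms(1)] in \<open>auto simp: bij_betw_def\<close>)
  have prod: "u (S \<union> R) * w X (S \<union> R) = u S * w C S * u R + u S * (u R * w D R)"
    if "S \<in> Inv C" "R \<in> Inv D" for S R
  proof -
    have SR: "S \<inter> R = {}" "finite S" "finite R" "S \<union> R \<subseteq> X" "p ` S = q ` S" "p ` R = q ` R"
      using that D finite_subset[of S C] finite_subset[of R D] by (auto simp: Inv_def)
    have "card (S \<union> R) = card S + card R" "card X = card C + card D"
      using card_Un_disjoint[OF SR(2,3,1)] card_Un_disjoint[OF D(5,6,4)] D(3) by simp_all
    moreover have "map_sign p (S \<union> R) * map_sign q (S \<union> R) =
        (map_sign p S * map_sign q S) * (map_sign p R * map_sign q R)"
      using SR inj_on_subset[OF inj(1) SR(4)] inj_on_subset[OF inj(2) SR(4)] by (intro map_sign_mult_Un)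
    ultimately have "u (S \<union> R) = u S * u R" "w X (S \<union> R) = w C S + w D R"
      by (simp_all add: u_def w_def power_add mult_ac)
    then show ?thesis
      by (simp add: algebra_simps)
  qed
  have "(\<Sum>S\<in>Inv X. u S * w X S) = (\<Sum>(S, R)\<in>Inv C \<times> Inv D. u (S \<union> R) * w X (S \<union> R))"
  proof (rule sum.reindex_bij_witness[where i = "\<lambda>(S, R). S \<union> R" and j = "\<lambda>S. (S \<inter> C, S \<inter> D)"], goal_cases)
    case (1 S)
    then show ?case using D by (auto simp: Inv_def)
  next
    case (2 S)
    have "p ` (S \<inter> Z) = q ` (S \<inter> Z)" if "Z \<subseteq> X" "p ` Z = q ` Z" for Z
      using inj_on_image_Int[OF inj(1), of S Z] inj_on_image_Int[OF inj(2), of S Z] 2 that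
      by (simp add: Inv_def)
    then show ?case using 2 D C by (auto simp: Inv_def)
  next
    case (3 b)
    then show ?case using D by (auto simp: Inv_def)
  next
    case (4 b)
    then show ?case using D by (auto simp: Inv_def image_Un)
  next
    case (5 S)
    then have "S \<inter> C \<union> S \<inter> D = S"
      using D by (auto simp: Inv_def)
    then show ?case by simp
  qed
  also have "\<dots> = (\<Sum>S\<in>Inv C. \<Sum>R\<in>Inv D. u (S \<union> R) * w X (S \<union> R))"
    by (simp add: sum.cartesian_product)
  also have "\<dots> = (\<Sum>S\<in>Inv C. u S * w C S) * sum u (Inv D) + sum u (Inv C) * (\<Sum>R\<in>Inv D. u R * w D R)"
    by (simp add: prod sum.distrib sum_product)
  also have "\<dots> = 0"
    using lef[of C] lef[of D] C D by auto
  finally show ?thesis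
    by (simp add: u_def w_def Inv_def mult_ac)
qed

section \<open>Vanishing of the alternating sum, and duality\<close>

lemma ext_form_0_eq: 
  assumes "bij_family X Y A"
  shows "ext_form X Y 0 A A = (real (card A))\<^sup>2"
proof -
  have "ext_form X Y 0 {p} {q} = 1" if "p \<in> A" "q \<in> A" for p q
  proof -
    have "{S \<in> layer X 0. p ` S = q ` S} = {{}}"
      using assms finite_subset by (fastforce simp: layer_def bij_family_def)
    then show ?thesis
      using that assms by (simp add: ext_form_pair bij_family_def)
  qed
  then show ?thesis
    by (subst ext_form_sum_pairs) (simp add: power2_eq_square)
qed

text \<open>Each pair of maps contributes a weighted Lefschetz sum, which vanishes thanks to
  \<open>C\<close>. The hypothesis covers the pairs with \<open>p = q\<close> too.\<close>

lemma std_form_alternating_sum_eq_0: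
  assumes "bij_family X Y A"
    and C: "\<And>p q. p \<in> A \<Longrightarrow> q \<in> A \<Longrightarrow> \<exists>C. C \<noteq> {} \<and> C \<subset> X \<and> p ` C = q ` C"
  shows "(\<Sum>j<card X. (-1) ^ j * std_form X Y j A A) = 0"
proof (cases "Y = {}")
  case True
  then show ?thesis
    using assms by (simp add: bij_family_def)
next
  case False
  have "(\<Sum>j<card X. (-1) ^ j * std_form X Y j A A) =
      (\<Sum>i\<le>card X. \<Sum>p\<in>A. \<Sum>q\<in>A. (-1) ^ i * (real (card X) - real i) * ext_form X Y i {p} {q})"
    using std_form_alternating_sum[OF assms(1,1) False] ext_form_sum_pairs[of X Y _ A A]
    by (simp add: sum_distrib_left)
  also have "\<dots> = (\<Sum>p\<in>A. \<Sum>i\<le>card X. \<Sum>q\<in>A. (-1) ^ i * (real (card X) - real i) * ext_form X Y i {p} {q})"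
    by (rule sum.swap)
  also have "\<dots> = (\<Sum>p\<in>A. \<Sum>q\<in>A. \<Sum>i\<le>card X. (-1) ^ i * (real (card X) - real i) * ext_form X Y i {p} {q})"
    by (intro sum.cong refl sum.swap)
  also have "\<dots> = 0"
  proof (rule sum.neutral, rule ballI, rule sum.neutral, rule ballI)
    fix p q assume pq: "p \<in> A" "q \<in> A"
    then have X: "finite X" "bij_betw p X Y" "bij_betw q X Y"
      using assms(1) by (auto simp: bij_family_def)
    obtain C where "C \<noteq> {}" "C \<subset> X" "p ` C = q ` C"
      using C[OF pq] by blast
    from weighted_lefschetz_sum_eq_0[OF X this]
    show "(\<Sum>i\<le>card X. (-1) ^ i * (real (card X) - real i) * ext_form X Y i {p} {q}) = 0"
      by (simp add: ext_form_pair[OF X] sum_distrib_left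
          flip: sum_layers[OF X(1), where P = "\<lambda>S. p ` S = q ` S"
            and f = "\<lambda>j S. (-1) ^ j * (real (card X) - real j) * (map_sign p S * map_sign q S)"])
  qed
  finally show ?thesis .
qed

text \<open>Complementation matches the invariant sets of sizes \<open>j\<close> and
  \<open>card X - j\<close>. The signs attached to a set and to its complement multiply to the sign
  of q^-1 p, which is 1 by constant parity.\<close>

lemma ext_form_dual:
  assumes "bij_family X Y A" "j \<le> card X"
    and sgn: "\<And>p q. p \<in> A \<Longrightarrow> q \<in> A \<Longrightarrow> map_sign p X = map_sign q X"
  shows "ext_form X Y (card X - j) A A = ext_form X Y j A A"
proof -
  have "ext_form X Y (card X - j) {p} {q} = ext_form X Y j {p} {q}" if pq: "p \<in> A" "q \<in> A" for p q
  proof -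
    have X: "finite X" "bij_betw p X Y" "bij_betw q X Y"
      using assms(1) pq by (auto simp: bij_family_def)
    have compl: "X - S \<subseteq> X" "X - (X - S) = S" "card (X - S) = card X - card S" "card S \<le> card X" if "S \<subseteq> X" for S
      using that X(1) card_mono finite_subset[OF that X(1)] by (auto simp: card_Diff_subset)
    show ?thesis
      unfolding ext_form_pair[OF X]
    proof (rule sum.reindex_bij_witness[where i = "\<lambda>S. X - S" and j = "\<lambda>S. X - S"], goal_cases)
      case (5 S)
      then have S: "S \<subseteq> X" "p ` S = q ` S"
        by (auto simp: layer_def)
      have "map_sign p (S \<union> (X - S)) * map_sign q (S \<union> (X - S)) =
          (map_sign p S * map_sign q S) * (map_sign p (X - S) * map_sign q (X - S))"
        using S X finite_subset image_complement_eq[OF X(2,3) S]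
        by (intro map_sign_mult_Un) (auto simp: bij_betw_def Un_absorb1)
      moreover have "S \<union> (X - S) = X"
        using S by auto
      ultimately have one: "(map_sign p S * map_sign q S) * (map_sign p (X - S) * map_sign q (X - S)) = 1"
        using sgn[OF pq] by simp
      have "map_sign p (X - S) * map_sign q (X - S) = (map_sign p S * map_sign p S) * (map_sign q S * map_sign q S) *
          (map_sign p (X - S) * map_sign q (X - S))"
        by simp
      also have "\<dots> = (map_sign p S * map_sign q S) *
          ((map_sign p S * map_sign q S) * (map_sign p (X - S) * map_sign q (X - S)))"
        by (simp only: mult_ac)
      finally show ?case
        by (simp add: one)
    qed (use compl assms(2) image_complement_eq[OF X(2,3)] in \<open>auto simp: layer_def\<close>)
  qed
  then show ?thesis
    by (subst (1 2) ext_form_sum_pairs) simp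
qed

text \<open>Duality passes from \<open>ext_form\<close> to \<open>std_form\<close> degree by degree:
  two dual values of \<open>ext_form\<close> both split into consecutive terms, of which one pair is
  already matched. The induction starts from the vanishing of \<open>std_form\<close> in degree
  \<open>card X\<close>.\<close>

lemma std_form_dual:
  assumes "bij_family X Y A" "j < card X"
    and sgn: "\<And>p q. p \<in> A \<Longrightarrow> q \<in> A \<Longrightarrow> map_sign p X = map_sign q X"
  shows "std_form X Y (card X - 1 - j) A A = std_form X Y j A A"
  using assms(2)
proof (induction j)
  have Y: "Y \<noteq> {}" "card Y = card X" "finite Y"
    using assms(1,2) by (auto simp: bij_family_def)
  note Suc_eq = ext_form_Suc[OF assms(1,1) Y(1)]
  note dual = ext_form_dual[OF assms(1) _ sgn]
  {
    case 0
    then have "ext_form X Y (card X) A A = std_form X Y (card X) A A + std_form X Y (card X - 1) A A"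
      using Suc_eq[of "card X - 1"] by simp
    then show ?case
      using dual[of 0] ext_form_0[OF assms(1,1) Y(1)] std_form_card[OF Y(3), of X A A] Y(2) by simp
  next
    case (Suc j)
    then obtain k where k: "card X = Suc (Suc (j + k))"
      using less_imp_Suc_add[OF Suc.prems] by auto
    have "ext_form X Y (Suc k) A A = ext_form X Y (Suc j) A A"
      using dual[of "Suc j"] by (simp add: k)
    moreover have "std_form X Y (Suc k) A A = std_form X Y j A A"
      using Suc.IH by (simp add: k)
    ultimately show ?case
      by (simp add: k Suc_eq)
  }
qed

section \<open>The bound for odd size and constant parity\<close>

text \<open>
  The condition on \<open>C\<close> says that \<open>q\<inverse> p\<close> is not a single cycle on its support.
\<close>

definition independent_family :: "'a::linorder set \<Rightarrow> 'b::linorder set \<Rightarrow> ('a \<Rightarrow> 'b) set \<Rightarrow> bool" where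
  "independent_family X Y A \<longleftrightarrow> bij_family X Y A \<and>
    (\<forall>p\<in>A. \<forall>q\<in>A. p \<noteq> q \<longrightarrow> (\<exists>C. C \<noteq> {} \<and> C \<subset> {x \<in> X. p x \<noteq> q x} \<and> p ` C = q ` C)) \<and>
    (\<forall>p\<in>A. \<forall>q\<in>A. map_sign p X = map_sign q X)"

lemma independent_familyD:
  assumes "independent_family X Y A"
  shows "bij_family X Y A"
    and "p \<in> A \<Longrightarrow> q \<in> A \<Longrightarrow> p \<noteq> q \<Longrightarrow> \<exists>C. C \<noteq> {} \<and> C \<subset> {x \<in> X. p x \<noteq> q x} \<and> p ` C = q ` C"
    and "p \<in> A \<Longrightarrow> q \<in> A \<Longrightarrow> map_sign p X = map_sign q X"
  using assms unfolding independent_family_def by blast+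

text \<open>Removing \<open>x\<close> changes all signs by the same factor, which depends only on
  \<open>x\<close> and \<open>y\<close>; and maps in one fibre agree at \<open>x\<close>, so their
  disagreement sets stay the same.\<close>

lemma independent_family_remove:
  assumes "independent_family X Y A" "x \<in> X" "y \<in> Y"
  shows "independent_family (X - {x}) (Y - {y}) {p\<in>A. p x = y}"
proof -
  have fam: "bij_family X Y A"
    by (rule independent_familyD(1)[OF assms(1)])
  have sign: "map_sign p (X - {x}) = map_sign p X * (pos_sign x (X - {x}) * pos_sign y (Y - {y}))"
    if "p \<in> A" "p x = y" for p
  proof -
    have p: "inj_on p X" "p ` X = Y" "finite X"
      using fam that by (auto simp: bij_family_def bij_betw_def)
    have X: "insert x (X - {x}) = X"
      using assms(2) by auto
    have "p ` (X - {x}) = Y - {y}"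
      using p that assms(2) inj_on_image_set_diff[of p X X "{x}"] by simp
    then have "map_sign p X = map_sign p (X - {x}) * pos_sign x (X - {x}) * pos_sign y (Y - {y})"
      using map_sign_insert[of "X - {x}" x p] p that X by simp
    then show ?thesis
      by (simp add: mult_ac)
  qed
  show ?thesis
    unfolding independent_family_def
  proof (intro conjI ballI impI)
    show "bij_family (X - {x}) (Y - {y}) {p\<in>A. p x = y}"
      by (rule bij_family_remove[OF fam assms(2,3)])
  next
    fix p q assume "p \<in> {p\<in>A. p x = y}" "q \<in> {p\<in>A. p x = y}"
    then have pq: "p \<in> A" "p x = y" "q \<in> A" "q x = y"
      by auto
    show "map_sign p (X - {x}) = map_sign q (X - {x})"
      using independent_familyD(3)[OF assms(1) pq(1,3)] by (simp only: sign pq)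
    have diff: "{z \<in> X. p z \<noteq> q z} = {z \<in> X - {x}. p z \<noteq> q z}"
      using pq by auto
    assume "p \<noteq> q"
    from independent_familyD(2)[OF assms(1) pq(1,3) this]
    show "\<exists>C. C \<noteq> {} \<and> C \<subset> {z \<in> X - {x}. p z \<noteq> q z} \<and> p ` C = q ` C"
      by (simp only: diff)
  qed
qed

section \<open>Iteration of the branching inequality\<close>

lemma sum_choose_Suc:
  fixes a :: "nat \<Rightarrow> real"
  shows "(\<Sum>j\<le>Suc k. real (Suc k choose j) * a j) = (\<Sum>j\<le>k. real (k choose j) * (a j + a (Suc j)))"
proof -
  have "(\<Sum>j\<le>Suc k. real (Suc k choose j) * a j) =
      (a 0 + (\<Sum>j\<le>k. real (k choose Suc j) * a (Suc j))) + (\<Sum>j\<le>k. real (k choose j) * a (Suc j))"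
    by (subst sum.atMost_Suc_shift) (simp add: algebra_simps sum.distrib)
  also have "a 0 + (\<Sum>j\<le>k. real (k choose Suc j) * a (Suc j)) = (\<Sum>j\<le>Suc k. real (k choose j) * a j)"
    by (subst sum.atMost_Suc_shift) simp
  also have "\<dots> = (\<Sum>j\<le>k. real (k choose j) * a j)"
    by simp
  finally show ?thesis
    by (simp add: algebra_simps sum.distrib)
qed

lemma sum_card_fibres_at:
  assumes "bij_family X Y A" "x \<in> X"
  shows "(\<Sum>y\<in>Y. real (card {p\<in>A. p x = y})) = real (card A)"
proof -
  have "(\<Sum>y\<in>Y. \<Sum>p | p \<in> A \<and> p x = y. 1 :: real) = (\<Sum>p\<in>A. 1)"
    by (rule sum.group) (use assms in \<open>auto simp: bij_family_def bij_betw_def\<close>)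
  then show ?thesis
    by simp
qed

lemma sum_card_fibres:
  assumes "bij_family X Y A"
  shows "(\<Sum>x\<in>X. \<Sum>y\<in>Y. real (card {p\<in>A. p x = y})) = real (card X) * real (card A)"
  by (simp add: sum_card_fibres_at[OF assms])

text \<open>Induction on the number \<open>k\<close> of removed points. Pascal's rule prepares the
  sum for \<open>std_form_step\<close>, and the sizes of all fibres add up to
  \<open>card X * card A\<close>, which accounts for the quotient of factorials. For
  \<open>k = 0\<close> one factor \<open>card A\<close> is bounded by \<open>c\<close>.\<close>

lemma sum_choose_std_form_le:
  assumes bound: "\<And>X Y A. independent_family X Y A \<Longrightarrow> card X = m \<Longrightarrow> real (card (A :: ('a::linorder \<Rightarrow> 'b::linorder) set)) \<le> c"
    and "independent_family X Y (A :: ('a \<Rightarrow> 'b) set)" "card X = m + k" "m \<ge> 1"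
  shows "(\<Sum>j\<le>k. real (k choose j) * std_form X Y j A A) \<le> c * (fact (m + k) / fact m) * real (card A)"
  using assms(2,3)
proof (induction k arbitrary: X Y A)
  case 0
  then have fam: "bij_family X Y A" "Y \<noteq> {}"
    using independent_familyD(1)[OF 0(1)] assms(4) by (auto simp: bij_family_def)
  have "std_form X Y 0 A A = (real (card A))\<^sup>2"
    using ext_form_0[OF fam(1,1,2)] ext_form_0_eq[OF fam(1)] by simp
  also have "\<dots> \<le> c * real (card A)"
    unfolding power2_eq_square using bound[OF 0(1)] 0 by (intro mult_right_mono) auto
  finally show ?case
    by simp
next
  case (Suc k)
  have fam: "bij_family X Y A" "finite X" "finite Y"
    using independent_familyD(1)[OF Suc.prems(1)] by (auto simp: bij_family_def)
  let ?std = "\<lambda>x y j. std_form (X - {x}) (Y - {y}) j {p\<in>A. p x = y} {p\<in>A. p x = y}"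
  have "(\<Sum>j\<le>Suc k. real (Suc k choose j) * std_form X Y j A A) =
      (\<Sum>j\<le>k. real (k choose j) * (std_form X Y j A A + std_form X Y (Suc j) A A))"
    by (rule sum_choose_Suc)
  also have "\<dots> \<le> (\<Sum>j\<le>k. real (k choose j) * (\<Sum>x\<in>X. \<Sum>y\<in>Y. ?std x y j))"
    using Suc.prems(2) assms(4) by (intro sum_mono mult_left_mono std_form_step[OF fam(1)]) auto
  also have "\<dots> = (\<Sum>j\<le>k. \<Sum>x\<in>X. \<Sum>y\<in>Y. real (k choose j) * ?std x y j)"
    by (simp add: sum_distrib_left)
  also have "\<dots> = (\<Sum>x\<in>X. \<Sum>j\<le>k. \<Sum>y\<in>Y. real (k choose j) * ?std x y j)"
    by (rule sum.swap)
  also have "\<dots> = (\<Sum>x\<in>X. \<Sum>y\<in>Y. \<Sum>j\<le>k. real (k choose j) * ?std x y j)"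
    by (intro sum.cong refl sum.swap)
  also have "\<dots> \<le> (\<Sum>x\<in>X. \<Sum>y\<in>Y. c * (fact (m + k) / fact m) * real (card {p\<in>A. p x = y}))"
  proof (intro sum_mono)
    fix x y assume xy: "x \<in> X" "y \<in> Y"
    show "(\<Sum>j\<le>k. real (k choose j) * ?std x y j) \<le> c * (fact (m + k) / fact m) * real (card {p\<in>A. p x = y})"
      by (rule Suc.IH[OF independent_family_remove[OF Suc.prems(1) xy]]) (use xy Suc.prems(2) fam(2) in simp)
  qed
  also have "\<dots> = c * (fact (m + k) / fact m) * (real (card X) * real (card A))"
    by (simp only: sum_card_fibres[OF fam(1), symmetric] sum_distrib_left)
  also have "\<dots> = c * (fact (m + Suc k) / fact m) * real (card A)"
    by (simp add: Suc.prems(2))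
  finally show ?case .
qed

section \<open>Numerical estimates\<close>

lemma central_binomial_Suc:
  "(real j + 1) * real (2 * Suc j choose Suc j) = 2 * (2 * real j + 1) * real (2 * j choose j)"
proof -
  have *: "real (2 * i choose i) = fact (2 * i) / (fact i * fact i)" for i
    by (subst binomial_fact) (simp_all add: mult_2)
  have f2: "fact (2 * Suc j) = 2 * (real j + 1) * (2 * real j + 1) * fact (2 * j)"
    by (simp add: algebra_simps)
  have f1: "fact (Suc j) = (real j + 1) * fact j"
    by (simp add: algebra_simps)
  have cancel: "k * (2 * k * c * F / (k * G * (k * G))) = 2 * c * (F / (G * G))" if "k \<noteq> 0" for k c F G :: real
    using that by simp
  show ?thesis
    unfolding * f1 f2 by (rule cancel) linarith
qed

text \<open>Here 252 is \<open>10 choose 5\<close>, and the ratio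
  \<open>2 * (2 * j + 1) / (j + 1)\<close> of consecutive central binomial coefficients is at least
  3 for \<open>j \<ge> 1\<close>.\<close>

lemma central_binomial_ge:
  "252 * 3 ^ r \<le> real (2 * (r + 5) choose (r + 5))"
proof (induction r)
  case 0
  show ?case by (simp add: numeral_eq_Suc)
next
  case (Suc r)
  have "(real (r + 5) + 1) * (252 * 3 ^ Suc r) = 3 * (real (r + 5) + 1) * (252 * 3 ^ r)"
    by simp
  also have "\<dots> \<le> 2 * (2 * real (r + 5) + 1) * real (2 * (r + 5) choose (r + 5))"
    by (rule mult_mono) (use Suc in auto)
  also have "\<dots> = (real (r + 5) + 1) * real (2 * Suc (r + 5) choose Suc (r + 5))"
    by (rule central_binomial_Suc[symmetric])
  finally have "252 * 3 ^ Suc r \<le> real (2 * Suc (r + 5) choose Suc (r + 5))"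
    by (rule mult_left_le_imp_le) simp
  then show ?case
    by (simp only: add_Suc)
qed

text \<open>Only a few of the nonnegative terms in \<open>le\<close> are kept: \<open>i = 1\<close>
  bounds \<open>a 1\<close>, \<open>i = 3\<close> bounds \<open>a 3\<close>, and for odd
  \<open>j \<ge> 5\<close> the central coefficient in the case \<open>i = j\<close> forces geometric
  decay.\<close>

lemma odd_sum_bound:
  fixes a :: "nat \<Rightarrow> real"
  assumes nonneg: "\<And>j. a j \<ge> 0" and "a 0 = 1"
    and le: "\<And>i. 1 \<le> i \<Longrightarrow> i \<le> m \<Longrightarrow> (\<Sum>j\<le>2 * i. real (2 * i choose j) * a j) \<le> 2 ^ i"
    and "2 * t + 1 \<le> m"
  shows "(\<Sum>s\<le>t. a (2 * s + 1)) < 1"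
proof -
  have sub: "(\<Sum>j\<in>J. real (2 * i choose j) * a j) \<le> 2 ^ i" if "J \<subseteq> {..2 * i}" "1 \<le> i" "i \<le> m" for i J
    using that by (intro order_trans[OF sum_mono2 le]) (auto simp: nonneg)
  have a1: "a 1 \<le> 1 / 2"
    using sub[of "{0, 1}" 1] assms by simp
  \<comment> \<open>At \<open>r = 0\<close> the bound is 7/10, which follows from
    \<open>a 1 \<le> 1 / 2\<close> and \<open>6 * a 1 + 20 * a 3 \<le> 7\<close>. Each later term is
    at most 32/252 times \<open>(4 / 9) ^ r\<close>, and the bound grows by 23/100 times 5/9 times
    \<open>(4 / 9) ^ r\<close>, which is more.\<close>
  have "(\<Sum>s\<le>Suc r. a (2 * s + 1)) \<le> 93 / 100 - 23 / 100 * (4 / 9) ^ r" if "2 * Suc r + 1 \<le> m" for r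
    using that
  proof (induction r)
    case 0
    have "(6 choose 3) = (20 :: nat)"
      by (simp add: numeral_eq_Suc)
    then have "1 + 6 * a 1 + 20 * a 3 \<le> 8"
      using sub[of "{0, 1, 3}" 3] 0 assms(2) by simp
    then show ?case
      using a1 by simp
  next
    case (Suc r)
    let ?j = "2 * r + 5"
    have "252 * 3 ^ (2 * r) * a ?j \<le> real (2 * ?j choose ?j) * a ?j"
      by (intro mult_right_mono central_binomial_ge nonneg)
    also have "\<dots> \<le> 2 ^ ?j"
      using sub[of "{?j}" ?j] Suc.prems by simp
    also have "\<dots> = 32 * 4 ^ r"
      by (simp add: power_add power_mult)
    finally have "a ?j \<le> 32 / 252 * (4 / 9) ^ r"
      using power_mult[of "3 :: real" 2 r] by (simp add: power_divide field_simps)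
    moreover have "2 * Suc (Suc r) + 1 = ?j"
      by simp
    then have "(\<Sum>s\<le>Suc (Suc r). a (2 * s + 1)) = (\<Sum>s\<le>Suc r. a (2 * s + 1)) + a ?j"
      by (simp only: sum.atMost_Suc[of _ "Suc r"])
    moreover have "(\<Sum>s\<le>Suc r. a (2 * s + 1)) \<le> 93 / 100 - 23 / 100 * (4 / 9) ^ r"
      using Suc by simp
    moreover have "(4 / 9 :: real) ^ Suc r = 4 / 9 * (4 / 9) ^ r" "(4 / 9 :: real) ^ r \<ge> 0"
      by simp_all
    ultimately show ?case
      by linarith
  qed
  note bound = this
  show ?thesis
  proof (cases t)
    case 0
    then show ?thesis
      using a1 by simp
  next
    case (Suc r)
    then have "(\<Sum>s\<le>t. a (2 * s + 1)) \<le> 93 / 100 - 23 / 100 * (4 / 9) ^ r"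
      using bound[of r] assms(4) by simp
    moreover have "(4 / 9 :: real) ^ r \<ge> 0"
      by simp
    ultimately show ?thesis
      by linarith
  qed
qed

text \<open>Reflection carries the odd indices up to \<open>m\<close> to those from \<open>m\<close>
  on, so all odd terms sum to less than 2, while \<open>a 0\<close> and \<open>a (2 * m)\<close>
  alone already give 2.\<close>

lemma alternating_sum_pos:
  fixes a :: "nat \<Rightarrow> real"
  assumes nonneg: "\<And>j. a j \<ge> 0" and "a 0 = 1" and "m \<ge> 1"
    and le: "\<And>i. 1 \<le> i \<Longrightarrow> i \<le> m \<Longrightarrow> (\<Sum>j\<le>2 * i. real (2 * i choose j) * a j) \<le> 2 ^ i"
    and dual: "\<And>j. j \<le> 2 * m \<Longrightarrow> a (2 * m - j) = a j"
  shows "(\<Sum>j\<le>2 * m. (-1) ^ j * a j) > 0"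
proof -
  define L where "L = {j. odd j \<and> j \<le> m}"
  \<comment> \<open>The largest \<open>s\<close> with \<open>2 * s + 1 \<le> m\<close>.\<close>
  define t where "t = (m - 1) div 2"
  have "L = (\<lambda>s. 2 * s + 1) ` {..t}"
  proof (intro equalityI subsetI)
    fix j assume "j \<in> L"
    then obtain s where "j = 2 * s + 1" "j \<le> m"
      by (auto simp: L_def elim: oddE)
    then show "j \<in> (\<lambda>s. 2 * s + 1) ` {..t}"
      by (auto simp: t_def)
  qed (use assms(3) in \<open>auto simp: L_def t_def\<close>)
  then have "sum a L = (\<Sum>s\<le>t. a (2 * s + 1))"
    by (simp add: sum.reindex inj_on_def)
  also have "\<dots> < 1"
    by (rule odd_sum_bound[OF nonneg assms(2) le]) (use assms(3) in \<open>auto simp: t_def\<close>)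
  finally have L: "sum a L < 1" .
  have finL: "finite L"
    by (simp add: L_def)
  \<comment> \<open>For odd \<open>m\<close> the middle index lies in both halves; counting it twice
    is harmless in an upper bound.\<close>
  have "sum a {j. odd j \<and> j \<le> 2 * m} \<le> sum a (L \<union> (\<lambda>j. 2 * m - j) ` L)"
  proof (rule sum_mono2)
    show "{j. odd j \<and> j \<le> 2 * m} \<subseteq> L \<union> (\<lambda>j. 2 * m - j) ` L"
    proof
      fix j assume j: "j \<in> {j. odd j \<and> j \<le> 2 * m}"
      show "j \<in> L \<union> (\<lambda>j. 2 * m - j) ` L"
      proof (cases "j \<le> m")
        case False
        then have "2 * m - j \<in> L" "j = 2 * m - (2 * m - j)"
          using j by (auto simp: L_def)
        then show ?thesis by blast
      qed (use j in \<open>simp add: L_def\<close>)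
    qed
  qed (use finL nonneg in auto)
  also have "\<dots> \<le> sum a L + sum a ((\<lambda>j. 2 * m - j) ` L)"
    using finL sum_nonneg[of _ a] nonneg by (simp add: sum_Un)
  also have "sum a ((\<lambda>j. 2 * m - j) ` L) = (\<Sum>j\<in>L. a (2 * m - j))"
    by (subst sum.reindex) (auto simp: inj_on_def L_def)
  also have "\<dots> = sum a L"
    by (rule sum.cong[OF refl], rule dual) (auto simp: L_def)
  finally have odd: "sum a {j. odd j \<and> j \<le> 2 * m} < 2"
    using L by simp
  have "2 = sum a {0, 2 * m}"
    using assms(2,3) dual[of 0] by simp
  also have "\<dots> \<le> sum a {j. even j \<and> j \<le> 2 * m}"
    by (rule sum_mono2) (use nonneg in auto)
  finally have even: "2 \<le> sum a {j. even j \<and> j \<le> 2 * m}" .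
  have "{..2 * m} = {j. even j \<and> j \<le> 2 * m} \<union> {j. odd j \<and> j \<le> 2 * m}"
    by auto
  then have "(\<Sum>j\<le>2 * m. (-1) ^ j * a j) =
      (\<Sum>j | even j \<and> j \<le> 2 * m. (-1) ^ j * a j) + (\<Sum>j | odd j \<and> j \<le> 2 * m. (-1) ^ j * a j)"
    by (simp only:) (rule sum.union_disjoint, auto)
  also have "\<dots> = sum a {j. even j \<and> j \<le> 2 * m} - sum a {j. odd j \<and> j \<le> 2 * m}"
    by (simp add: sum_negf)
  finally show ?thesis
    using odd even by simp
qed

section \<open>Induction on the odd size\<close>

lemma independent_family_card_le:
  fixes A :: "('a::linorder \<Rightarrow> 'b::linorder) set"
  assumes "independent_family X Y A" "card X = 2 * m + 1"
  shows "real (card A) \<le> fact (2 * m + 1) / 2 ^ m"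
  using assms
proof (induction m arbitrary: X Y A rule: less_induct)
  case (less m)
  have fam: "bij_family X Y A" "finite X" "finite A" "Y \<noteq> {}"
    using independent_familyD(1)[OF less.prems(1)] less.prems(2) by (auto simp: bij_family_def)
  note indep = independent_familyD(2)[OF less.prems(1)]
  note sgn = independent_familyD(3)[OF less.prems(1)]
  show ?case
  proof (cases "m = 0")
    case True
    then obtain z where X: "X = {z}"
      using less.prems(2) by (auto simp: card_1_singleton_iff)
    \<comment> \<open>A disagreement set inside a single point has no nonempty proper
      subset.\<close>
    have "p = q" if "p \<in> A" "q \<in> A" for p q
      using indep[OF that] by (auto simp: X)
    then have "card A \<le> 1"
      using fam(3) by (auto simp: card_le_Suc0_iff_eq)
    then show ?thesis
      by (simp add: True)
  next
    case False
    show ?thesis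
    proof (rule ccontr)
      assume "\<not> ?thesis"
      then have big: "fact (2 * m + 1) / 2 ^ m < real (card A)"
        by simp
      define a where "a = (\<lambda>j. std_form X Y j A A / (real (card A))\<^sup>2)"
      have A: "real (card A) > 0"
        by (rule le_less_trans[OF _ big]) simp
      have "(\<Sum>j\<le>2 * m. (-1) ^ j * a j) > 0"
      proof (rule alternating_sum_pos)
        show "a j \<ge> 0" for j
          by (simp add: a_def std_form_nonneg)
        show "a 0 = 1"
          using A by (simp add: a_def ext_form_0_eq[OF fam(1)] flip: ext_form_0[OF fam(1,1,4)])
        show "m \<ge> 1"
          using False by simp
        show "a (2 * m - j) = a j" if "j \<le> 2 * m" for j
          using std_form_dual[OF fam(1) _ sgn, of j] that less.prems(2) by (simp add: a_def)
        show "(\<Sum>j\<le>2 * i. real (2 * i choose j) * a j) \<le> 2 ^ i" if i: "1 \<le> i" "i \<le> m" for i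
        proof -
          \<comment> \<open>Removing \<open>2 * i\<close> points leaves the odd size
            \<open>l\<close>, to which the induction hypothesis applies with \<open>m - i\<close>.
            Once \<open>fact l\<close> cancels, the assumed lower bound on \<open>card A\<close>
            absorbs the remaining factorial and leaves \<open>2 ^ i\<close>.\<close>
          define l where "l = 2 * (m - i) + 1"
          have l: "l + 2 * i = 2 * m + 1"
            using i by (simp add: l_def)
          have "(\<Sum>j\<le>2 * i. real (2 * i choose j) * std_form X Y j A A) \<le>
              fact l / 2 ^ (m - i) * (fact (l + 2 * i) / fact l) * real (card A)"
          proof (rule sum_choose_std_form_le[OF _ less.prems(1)])
            fix X' Y' and A' :: "('a \<Rightarrow> 'b) set"
            assume "independent_family X' Y' A'" "card X' = l"
            then show "real (card A') \<le> fact l / 2 ^ (m - i)"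
              unfolding l_def using i by (intro less.IH) auto
          qed (use less.prems(2) l in \<open>auto simp: l_def\<close>)
          also have "\<dots> = 2 ^ i * (fact (2 * m + 1) / 2 ^ m) * real (card A)"
            using i by (simp add: l power_diff)
          also have "\<dots> \<le> 2 ^ i * real (card A) * real (card A)"
            using big by (intro mult_right_mono mult_left_mono) auto
          finally show ?thesis
            using A by (simp add: a_def field_simps power2_eq_square flip: sum_divide_distrib)
        qed
      qed
      moreover have "(\<Sum>j\<le>2 * m. (-1) ^ j * a j) = (\<Sum>j<card X. (-1) ^ j * std_form X Y j A A) / (real (card A))\<^sup>2"
        using less.prems(2) by (simp add: a_def sum_divide_distrib lessThan_Suc_atMost)
      moreover have "(\<Sum>j<card X. (-1) ^ j * std_form X Y j A A) = 0"
      proof (rule std_form_alternating_sum_eq_0[OF fam(1)])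
        fix p q assume pq: "p \<in> A" "q \<in> A"
        show "\<exists>C. C \<noteq> {} \<and> C \<subset> X \<and> p ` C = q ` C"
        proof (cases "p = q")
          \<comment> \<open>Any single point serves for the diagonal pairs, as \<open>X\<close> has
            more than one.\<close>
          case True
          obtain z where "z \<in> X"
            using less.prems(2) by fastforce
          moreover have "X \<noteq> {z}"
            using less.prems(2) False by auto
          ultimately show ?thesis
            using True by (intro exI[of _ "{z}"]) auto
        next
          case False
          from indep[OF pq this] show ?thesis
            by blast
        qed
      qed
      ultimately show False
        by simp
    qed
  qed
qed

section \<open>Cycles in the symmetric group\<close>

text \<open>\<open>support p a\<close> lists the orbit of \<open>a\<close>. By the last assumption
  \<open>p\<close> is the identity outside it, so \<open>p\<close> is the cycle along this
  list.\<close>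

lemma support_eq_imp_cycle:
  assumes "p permutes {1..n}" "p a \<noteq> a" "set (support p a) = {x. p x \<noteq> x}"
  shows "p \<in> cycles n"
proof -
  have perm: "permutation p"
    using assms(1) permutation_permutes by blast
  have "p = cycle_of_list (support p a)"
  proof
    fix x
    show "p x = cycle_of_list (support p a) x"
    proof (cases "x \<in> set (support p a)")
      case True
      then show ?thesis
        by (rule cycle_restrict[OF perm])
    next
      case False
      moreover from False have "p x = x"
        unfolding assms(3) by simp
      ultimately show ?thesis
        using id_outside_supp by metis
    qed
  qed
  moreover have "cycle (support p a)"
    by (rule cycle_of_permutation[OF perm])
  moreover have "set (support p a) \<subseteq> {1..n}"
    using assms(1) unfolding assms(3) by (auto simp: permutes_def)
  moreover have "length (support p a) \<ge> 2"
    using least_power_gt_one[OF perm assms(2)] by simp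
  ultimately show ?thesis
    unfolding cycles_def by blast
qed

text \<open>The witness is the preimage under \<open>q\<close> of one nontrivial orbit
  \<open>E\<close> of the quotient \<open>t\<close>. It lies in the disagreement set because
  \<open>t\<close> moves every point of \<open>E\<close>; if it were the whole set, \<open>E\<close>
  would be the support of \<open>t\<close> and \<open>t\<close> a cycle.\<close>

lemma noncycle_quotient_invariant_set:
  assumes "p permutes {1..n}" "q permutes {1..n}" "p \<noteq> q" "p \<circ> inv' q \<notin> cycles n"
  shows "\<exists>C. C \<noteq> {} \<and> C \<subset> {x \<in> {1..n}. p x \<noteq> q x} \<and> p ` C = q ` C"
proof -
  define t where "t = p \<circ> inv' q"
  have t: "t permutes {1..n}"
    unfolding t_def by (intro permutes_compose permutes_inv assms(1,2))
  have perm: "permutation t"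
    using t permutation_permutes by blast
  have tq: "t (q x) = p x" for x
    using permutes_inverses(2)[OF assms(2)] by (simp add: t_def)
  obtain d where "p d \<noteq> q d"
    using assms(3) by auto
  define y where "y = q d"
  define E where "E = set (support t y)"
  have E: "E = range (\<lambda>i. (t ^^ i) y)"
    unfolding E_def by (rule support_set[OF perm])
  have ty: "t y \<noteq> y"
    using \<open>p d \<noteq> q d\<close> by (simp add: y_def tq)
  have "t ((t ^^ i) y) \<in> E" for i
    unfolding E using rangeI[of "\<lambda>i. (t ^^ i) y" "Suc i"] by simp
  then have "t ` E \<subseteq> E"
    by (auto simp: E)
  then have tE: "t ` E = E"
    using endo_inj_surj[of E t] t permutes_inj_on[OF t] by (simp add: E_def)
  have moved: "t z \<noteq> z" if z: "z \<in> E" for z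
  proof
    assume "t z = z"
    obtain i where "z = (t ^^ i) y"
      using z E by auto
    then have "(t ^^ i) (t y) = (t ^^ i) y"
      using \<open>t z = z\<close> by (simp add: funpow_swap1)
    moreover have "inj (t ^^ i)"
      using permutes_inj[OF t] by (simp add: inj_fn)
    ultimately show False
      using ty by (simp add: inj_eq)
  qed
  define C where "C = inv' q ` E"
  have qC: "q ` C = E"
    using permutes_inverses(1)[OF assms(2)] by (simp add: C_def image_comp comp_def)
  have "p ` C = t ` (q ` C)"
    by (simp add: image_comp comp_def tq)
  then have "p ` C = q ` C"
    by (simp add: qC tE)
  moreover have "C \<noteq> {}"
    by (simp add: C_def E)
  moreover have sub: "C \<subseteq> {x \<in> {1..n}. p x \<noteq> q x}"
  proof
    fix x assume "x \<in> C"
    then have "q x \<in> E"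
      using qC by auto
    then have "p x \<noteq> q x"
      using moved tq by metis
    moreover from this have "x \<in> {1..n}"
      using assms(1,2) unfolding permutes_def by metis
    ultimately show "x \<in> {x \<in> {1..n}. p x \<noteq> q x}"
      by simp
  qed
  moreover have "C \<noteq> {x \<in> {1..n}. p x \<noteq> q x}"
  proof
    assume C: "C = {x \<in> {1..n}. p x \<noteq> q x}"
    have "z \<in> E" if "t z \<noteq> z" for z
    proof -
      obtain x where x: "z = q x"
        using permutes_surj[OF assms(2)] by (metis surjD)
      then have "p x \<noteq> q x"
        using that tq by metis
      moreover from this have "x \<in> {1..n}"
        using assms(1,2) unfolding permutes_def by metis
      ultimately show ?thesis
        using C qC x by blast
    qed
    then have "E = {x. t x \<noteq> x}"
      using moved by auto
    then have "t \<in> cycles n"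
      using support_eq_imp_cycle[OF t ty] by (simp add: E_def)
    then show False
      using assms(4) by (simp add: t_def)
  qed
  ultimately show ?thesis
    by blast
qed

section \<open>From constant parity to arbitrary independent sets\<close>

lemma map_sign_cases: "map_sign f S = 1 \<or> map_sign f S = -1"
  using map_sign_square[of f S] by (simp only: square_eq_1_iff)

text \<open>The two parity classes are bounded separately, hence the factor 2.\<close>

lemma card_le_of_odd:
  fixes A :: "('a::linorder \<Rightarrow> 'b::linorder) set"
  assumes "bij_family X Y A" "card X = 2 * m + 1"
    and indep: "\<And>p q. p \<in> A \<Longrightarrow> q \<in> A \<Longrightarrow> p \<noteq> q \<Longrightarrow>
      \<exists>C. C \<noteq> {} \<and> C \<subset> {x \<in> X. p x \<noteq> q x} \<and> p ` C = q ` C"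
  shows "real (card A) \<le> 2 * (fact (2 * m + 1) / 2 ^ m)"
proof -
  define B where "B = (\<lambda>s. {p \<in> A. map_sign p X = s})"
  have "real (card (B s)) \<le> fact (2 * m + 1) / 2 ^ m" for s
  proof (rule independent_family_card_le)
    show "independent_family X Y (B s)"
      unfolding independent_family_def
    proof (intro conjI ballI impI)
      show "bij_family X Y (B s)"
        using assms(1) by (simp add: bij_family_def B_def)
    next
      fix p q assume "p \<in> B s" "q \<in> B s" "p \<noteq> q"
      then show "\<exists>C. C \<noteq> {} \<and> C \<subset> {x \<in> X. p x \<noteq> q x} \<and> p ` C = q ` C"
        by (intro indep) (simp_all add: B_def)
    qed (simp add: B_def)
  qed (rule assms(2))
  note B = this
  have "A = B 1 \<union> B (-1)"
    using map_sign_cases by (auto simp: B_def)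
  then have "real (card A) \<le> real (card (B 1)) + real (card (B (-1)))"
    using card_Un_le[of "B 1" "B (-1)"] by simp
  also have "\<dots> \<le> 2 * (fact (2 * m + 1) / 2 ^ m)"
    using B[of 1] B[of "-1"] by linarith
  finally show ?thesis .
qed

theorem theorem1p8:
  fixes n :: nat and A :: "(nat \<Rightarrow> nat) set"
  assumes "n \<ge> 1"
    and "independent_set (birkhoff_graph n) A"
  shows "real (card A) \<le> fact n / 2 powr ((real n - 4) / 2)"
proof -
  define X where "X = {1..n}"
  have perm: "p permutes X" if "p \<in> A" for p
    using assms(2) that by (auto simp: independent_set_birkhoff_graph_iff X_def)
  have "A \<subseteq> {p. p permutes X}"
    using perm by auto
  then have "finite A"
    using finite_permutations[of X] finite_subset by (auto simp: X_def)
  then have fam: "bij_family X X A"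
    using perm permutes_imp_bij by (auto simp: bij_family_def X_def)
  have indep: "\<exists>C. C \<noteq> {} \<and> C \<subset> {x \<in> X. p x \<noteq> q x} \<and> p ` C = q ` C"
    if "p \<in> A" "q \<in> A" "p \<noteq> q" for p q
    unfolding X_def
    by (rule noncycle_quotient_invariant_set)
       (use that assms(2) in \<open>auto simp: independent_set_birkhoff_graph_iff\<close>)
  show ?thesis
  proof (cases "odd n")
    case True
    then obtain m where m: "n = 2 * m + 1"
      by (elim oddE)
    have "real (card A) \<le> 2 * (fact (2 * m + 1) / 2 ^ m)"
      by (rule card_le_of_odd[OF fam _ indep]) (simp_all add: X_def m)
    \<comment> \<open>The exponent \<open>real m - 1\<close> is \<open>(real n - 3) / 2\<close>, so
      odd \<open>n\<close> leaves a factor \<open>sqrt 2\<close> to spare.\<close>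
    also have "\<dots> = fact n / 2 powr (real m - 1)"
      by (simp add: m powr_diff powr_realpow)
    also have "\<dots> \<le> fact n / 2 powr ((real n - 4) / 2)"
      by (intro divide_left_mono mult_pos_pos powr_mono) (simp_all add: m)
    finally show ?thesis .
  next
    case False
    then obtain k where k: "n = 2 * k"
      by (auto elim: evenE)
    with assms(1) obtain m where "k = Suc m"
      by (cases k) auto
    with k have m: "n = 2 * m + 2"
      by simp
    \<comment> \<open>For even \<open>n\<close>, sorting by the image of the point 1 gives
      \<open>n\<close> families on sets of odd size \<open>n - 1\<close>, and the resulting exponent
      is exactly the claimed one.\<close>
    have 1: "1 \<in> X"
      by (simp add: X_def m)
    have "real (card {p \<in> A. p 1 = y}) \<le> 2 * (fact (2 * m + 1) / 2 ^ m)" if y: "y \<in> X" for y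
    proof (rule card_le_of_odd[OF bij_family_remove[OF fam 1 y]])
      fix p q assume pq: "p \<in> {p \<in> A. p 1 = y}" "q \<in> {p \<in> A. p 1 = y}" "p \<noteq> q"
      then have "{x \<in> X - {1}. p x \<noteq> q x} = {x \<in> X. p x \<noteq> q x}"
        by auto
      then show "\<exists>C. C \<noteq> {} \<and> C \<subset> {x \<in> X - {1}. p x \<noteq> q x} \<and> p ` C = q ` C"
        using indep[of p q] pq by simp
    qed (simp add: X_def m)
    then have "(\<Sum>y\<in>X. real (card {p \<in> A. p 1 = y})) \<le> (\<Sum>y\<in>X. 2 * (fact (2 * m + 1) / 2 ^ m))"
      by (rule sum_mono)
    moreover have "(\<Sum>y\<in>X. real (card {p \<in> A. p 1 = y})) = real (card A)"
      by (rule sum_card_fibres_at[OF fam 1])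
    ultimately have "real (card A) \<le> real n * (2 * (fact (2 * m + 1) / 2 ^ m))"
      by (simp add: X_def)
    also have "\<dots> = fact n / 2 powr (real m - 1)"
      by (simp add: m powr_diff powr_realpow)
    also have "real m - 1 = (real n - 4) / 2"
      by (simp add: m)
    finally show ?thesis .
  qed
qed

end
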